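(* Let $n\ge 2$ and $0\le k\le n$ be integers, with $k<n$ if $n=2$. Then there exists a symplectic Lie group $(G,\omega)$ of dimension $2n$ with a left invariant positive compatible almost complex structure $J$ such that the distribution $\operatorname{Im} N^{J}$ has constant rank equal to $2k$. Moreover, when $0<k<n$, each of the four possible combinations of involutivity properties of the two distributions $\operatorname{Im} N^{J}$ and $(\operatorname{Im} N^{J})^\perp$ (both involutive; both non involutive; the first involutive and the second not; the second involutive and the first not) is realized by such a $(G,\omega,J)$ with $\operatorname{Im} N^J$ of constant rank $2k$.
   Context: A symplectic Lie group is a Lie group $G$ equipped with a left invariant symplectic form $\omega$. An almost complex structure $J$ (a smooth field of endomorphisms of the tangent bundle with $J^2=-\mathrm{Id}$) is compatible with $\omega$ if $g_J(X,Y):=\omega(X,JY)$ is symmetric, and positive if moreover $g_J$ is positive definite. Its Nijenhuis tensor is $N^J(X,Y)=[JX,JY]-J[JX,Y]-J[X,JY]-[X,Y]$. The distribution $\operatorname{Im} N^J$ assigns to a point $x$ the linear span of all the values $N^J_x(X,Y)$, $X,Y$ tangent vectors at $x$; $(\operatorname{Im} N^J)^\perp$ assigns to $x$ the $\omega_x$-orthogonal complement of $(\operatorname{Im} N^J)_x$ (which coincides with its $g_J$-orthogonal complement, since $(\operatorname{Im} N^J)_x$ is $J$-stable). A constant rank distribution is involutive if the bracket of any two vector fields with values in it again has values in it. *)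

theory Defs
  imports "HOL-Analysis.Analysis" "HOL-Algebra.Group"
begin

section \<open>Smooth maps between Euclidean spaces\<close>

text \<open>
  These two notions are meant for open sets \<open>S\<close>. Since the spaces are finite-dimensional, a map
  is \<open>C\<^sup>k\<^sup>+\<^sup>1\<close> iff it is differentiable and all its directional derivatives are \<open>C\<^sup>k\<close>.
\<close>

primrec Ck_on :: "nat \<Rightarrow> 'a::euclidean_space set \<Rightarrow> ('a \<Rightarrow> 'b::euclidean_space) \<Rightarrow> bool" where
  "Ck_on 0 S f \<longleftrightarrow> continuous_on S f"
| "Ck_on (Suc k) S f \<longleftrightarrow>
     (\<forall>x\<in>S. f differentiable (at x)) \<and> (\<forall>v. Ck_on k S (\<lambda>x. frechet_derivative f (at x) v))"

definition smooth_on :: "'a::euclidean_space set \<Rightarrow> ('a \<Rightarrow> 'b::euclidean_space) \<Rightarrow> bool" where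
  "smooth_on S f \<longleftrightarrow> (\<forall>k. Ck_on k S f)"


section \<open>Smooth manifolds\<close>

type_synonym ('p, 'e) chart = "'p set \<times> ('p \<Rightarrow> 'e)"

abbreviation cdom :: "('p, 'e) chart \<Rightarrow> 'p set" where
  "cdom c \<equiv> fst c"

abbreviation cmap :: "('p, 'e) chart \<Rightarrow> 'p \<Rightarrow> 'e" where
  "cmap c \<equiv> snd c"

abbreviation cimg :: "('p, 'e) chart \<Rightarrow> 'e set" where
  "cimg c \<equiv> cmap c ` cdom c"

abbreviation cinv :: "('p, 'e) chart \<Rightarrow> 'e \<Rightarrow> 'p" where
  "cinv c \<equiv> inv_into (cdom c) (cmap c)"

text \<open>
  The points of a manifold form the set \<^term>\<open>topspace (mtop M)\<close>. The topology is
  that of \<open>mtop M\<close>, also when the type \<open>'p\<close> carries a topology of its own. The atlas need not be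
  maximal. The dimension is that of the model space \<open>'e\<close>.
\<close>

record ('p, 'e) manifold =
  mtop :: "'p topology"
  atlas :: "('p, 'e) chart set"

definition second_countable :: "'p topology \<Rightarrow> bool" where
  "second_countable X \<longleftrightarrow>
     (\<exists>\<B>. countable \<B> \<and> (\<forall>V\<in>\<B>. openin X V) \<and>
          (\<forall>U x. openin X U \<and> x \<in> U \<longrightarrow> (\<exists>V\<in>\<B>. x \<in> V \<and> V \<subseteq> U)))"

definition smooth_manifold :: "('p, 'e::euclidean_space) manifold \<Rightarrow> bool" where
  "smooth_manifold M \<longleftrightarrow>
     Hausdorff_space (mtop M) \<and> second_countable (mtop M) \<and>
     topspace (mtop M) = (\<Union>c\<in>atlas M. cdom c) \<and>
     (\<forall>c\<in>atlas M. openin (mtop M) (cdom c) \<and> open (cimg c) \<and>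
        homeomorphic_map (subtopology (mtop M) (cdom c)) (top_of_set (cimg c)) (cmap c)) \<and>
     (\<forall>c\<in>atlas M. \<forall>d\<in>atlas M. smooth_on (cmap c ` (cdom c \<inter> cdom d)) (cmap d \<circ> cinv c))"

definition smooth_map ::
  "('p, 'e::euclidean_space) manifold \<Rightarrow> ('q, 'f::euclidean_space) manifold \<Rightarrow> ('p \<Rightarrow> 'q) \<Rightarrow> bool"
where
  "smooth_map M N f \<longleftrightarrow>
     continuous_map (mtop M) (mtop N) f \<and>
     (\<forall>c\<in>atlas M. \<forall>d\<in>atlas N.
        smooth_on (cmap c ` {p \<in> cdom c. f p \<in> cdom d}) (cmap d \<circ> f \<circ> cinv c))"

definition prod_manifold ::
  "('p, 'e) manifold \<Rightarrow> ('q, 'f) manifold \<Rightarrow> ('p \<times> 'q, 'e \<times> 'f) manifold"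
where
  "prod_manifold M N =
     \<lparr>mtop = prod_topology (mtop M) (mtop N),
      atlas = {(cdom c \<times> cdom d, map_prod (cmap c) (cmap d)) | c d. c \<in> atlas M \<and> d \<in> atlas N}\<rparr>"


section \<open>Tangent vectors and tensor fields\<close>

text \<open>
  For each point \<open>p\<close> a chart around \<open>p\<close> is singled out, and the tangent space at \<open>p\<close> is
  identified with the model space \<open>'e\<close> through that chart. So every tangent space is the type
  \<open>'e\<close>, a vector field is a function \<^typ>\<open>'p \<Rightarrow> 'e\<close>, a field of endomorphisms of the tangent bundle
  is a function \<^typ>\<open>'p \<Rightarrow> 'e \<Rightarrow> 'e\<close>, and a field of bilinear forms is a function
  \<^typ>\<open>'p \<Rightarrow> 'e \<Rightarrow> 'e \<Rightarrow> real\<close>. Values outside of the manifold are irrelevant. Because the chosen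
  chart may jump from point to point, smoothness and derivatives of such fields only
  make sense for their expressions in a single chart, introduced below.
\<close>

definition chart_at :: "('p, 'e) manifold \<Rightarrow> 'p \<Rightarrow> ('p, 'e) chart" where
  "chart_at M p = (SOME c. c \<in> atlas M \<and> p \<in> cdom c)"

definition tangent_map ::
  "('p, 'e::euclidean_space) manifold \<Rightarrow> ('q, 'f::euclidean_space) manifold
     \<Rightarrow> ('p \<Rightarrow> 'q) \<Rightarrow> 'p \<Rightarrow> 'e \<Rightarrow> 'f"
where
  "tangent_map M N f p =
     frechet_derivative (cmap (chart_at N (f p)) \<circ> f \<circ> cinv (chart_at M p))
       (at (cmap (chart_at M p) p))"

text \<open>
  \<open>coords M c p v\<close> is the coordinate vector in the chart \<open>c\<close> of the tangent vector \<open>v\<close> at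
  \<open>p\<close>; \<open>vec_of_coords M c p\<close> is the inverse map.
\<close>

definition coords ::
  "('p, 'e::euclidean_space) manifold \<Rightarrow> ('p, 'e) chart \<Rightarrow> 'p \<Rightarrow> 'e \<Rightarrow> 'e"
where
  "coords M c p =
     frechet_derivative (cmap c \<circ> cinv (chart_at M p)) (at (cmap (chart_at M p) p))"

definition vec_of_coords ::
  "('p, 'e::euclidean_space) manifold \<Rightarrow> ('p, 'e) chart \<Rightarrow> 'p \<Rightarrow> 'e \<Rightarrow> 'e"
where
  "vec_of_coords M c p =
     frechet_derivative (cmap (chart_at M p) \<circ> cinv c) (at (cmap c p))"

definition local_vf ::
  "('p, 'e::euclidean_space) manifold \<Rightarrow> ('p, 'e) chart \<Rightarrow> ('p \<Rightarrow> 'e) \<Rightarrow> 'e \<Rightarrow> 'e"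
where
  "local_vf M c X y = coords M c (cinv c y) (X (cinv c y))"

definition local_endo ::
  "('p, 'e::euclidean_space) manifold \<Rightarrow> ('p, 'e) chart \<Rightarrow> ('p \<Rightarrow> 'e \<Rightarrow> 'e) \<Rightarrow> 'e \<Rightarrow> 'e \<Rightarrow> 'e"
where
  "local_endo M c J y u =
     coords M c (cinv c y) (J (cinv c y) (vec_of_coords M c (cinv c y) u))"

definition local_form ::
  "('p, 'e::euclidean_space) manifold \<Rightarrow> ('p, 'e) chart
     \<Rightarrow> ('p \<Rightarrow> 'e \<Rightarrow> 'e \<Rightarrow> real) \<Rightarrow> 'e \<Rightarrow> 'e \<Rightarrow> 'e \<Rightarrow> real"
where
  "local_form M c \<omega> y u v =
     \<omega> (cinv c y) (vec_of_coords M c (cinv c y) u) (vec_of_coords M c (cinv c y) v)"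

definition vector_field :: "('p, 'e::euclidean_space) manifold \<Rightarrow> ('p \<Rightarrow> 'e) \<Rightarrow> bool" where
  "vector_field M X \<longleftrightarrow> (\<forall>c\<in>atlas M. smooth_on (cimg c) (local_vf M c X))"

definition endo_field :: "('p, 'e::euclidean_space) manifold \<Rightarrow> ('p \<Rightarrow> 'e \<Rightarrow> 'e) \<Rightarrow> bool" where
  "endo_field M J \<longleftrightarrow>
     (\<forall>p\<in>topspace (mtop M). linear (J p)) \<and>
     (\<forall>c\<in>atlas M. \<forall>u. smooth_on (cimg c) (\<lambda>y. local_endo M c J y u))"

definition two_form ::
  "('p, 'e::euclidean_space) manifold \<Rightarrow> ('p \<Rightarrow> 'e \<Rightarrow> 'e \<Rightarrow> real) \<Rightarrow> bool"
where
  "two_form M \<omega> \<longleftrightarrow>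
     (\<forall>p\<in>topspace (mtop M). bilinear (\<omega> p) \<and> (\<forall>u. \<omega> p u u = 0)) \<and>
     (\<forall>c\<in>atlas M. \<forall>u v. smooth_on (cimg c) (\<lambda>y. local_form M c \<omega> y u v))"

text \<open>
  The exterior derivative of a 2-form in a chart, evaluated on three constant
  coordinate vector fields.
\<close>

definition ext_deriv ::
  "('p, 'e::euclidean_space) manifold \<Rightarrow> ('p, 'e) chart
     \<Rightarrow> ('p \<Rightarrow> 'e \<Rightarrow> 'e \<Rightarrow> real) \<Rightarrow> 'e \<Rightarrow> 'e \<Rightarrow> 'e \<Rightarrow> 'e \<Rightarrow> real"
where
  "ext_deriv M c \<omega> y u v w =
       frechet_derivative (\<lambda>z. local_form M c \<omega> z v w) (at y) u
     - frechet_derivative (\<lambda>z. local_form M c \<omega> z u w) (at y) v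
     + frechet_derivative (\<lambda>z. local_form M c \<omega> z u v) (at y) w"

definition closed_form ::
  "('p, 'e::euclidean_space) manifold \<Rightarrow> ('p \<Rightarrow> 'e \<Rightarrow> 'e \<Rightarrow> real) \<Rightarrow> bool"
where
  "closed_form M \<omega> \<longleftrightarrow>
     (\<forall>c\<in>atlas M. \<forall>y\<in>cimg c. \<forall>u v w. ext_deriv M c \<omega> y u v w = 0)"

definition symplectic_form ::
  "('p, 'e::euclidean_space) manifold \<Rightarrow> ('p \<Rightarrow> 'e \<Rightarrow> 'e \<Rightarrow> real) \<Rightarrow> bool"
where
  "symplectic_form M \<omega> \<longleftrightarrow>
     two_form M \<omega> \<and> closed_form M \<omega> \<and>
     (\<forall>p\<in>topspace (mtop M). \<forall>u. (\<forall>v. \<omega> p u v = 0) \<longrightarrow> u = 0)"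

text \<open>
  The bracket at \<open>p\<close> is computed in the chart through which the tangent space at \<open>p\<close> is
  identified with \<open>'e\<close>, by the formula \<open>[X, Y] = DY(X) - DX(Y)\<close>.
\<close>

definition lie_bracket ::
  "('p, 'e::euclidean_space) manifold \<Rightarrow> ('p \<Rightarrow> 'e) \<Rightarrow> ('p \<Rightarrow> 'e) \<Rightarrow> 'p \<Rightarrow> 'e"
where
  "lie_bracket M X Y p =
     (let c = chart_at M p; y = cmap c p in
        frechet_derivative (local_vf M c Y) (at y) (local_vf M c X y)
      - frechet_derivative (local_vf M c X) (at y) (local_vf M c Y y))"


section \<open>Almost complex structures and the Nijenhuis tensor\<close>

definition almost_complex :: "('p, 'e::euclidean_space) manifold \<Rightarrow> ('p \<Rightarrow> 'e \<Rightarrow> 'e) \<Rightarrow> bool" where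
  "almost_complex M J \<longleftrightarrow>
     endo_field M J \<and> (\<forall>p\<in>topspace (mtop M). \<forall>u. J p (J p u) = - u)"

definition assoc_metric ::
  "('p \<Rightarrow> 'e \<Rightarrow> 'e \<Rightarrow> real) \<Rightarrow> ('p \<Rightarrow> 'e \<Rightarrow> 'e) \<Rightarrow> 'p \<Rightarrow> 'e \<Rightarrow> 'e \<Rightarrow> real"
where
  "assoc_metric \<omega> J p u v = \<omega> p u (J p v)"

definition compatible ::
  "('p, 'e::euclidean_space) manifold \<Rightarrow> ('p \<Rightarrow> 'e \<Rightarrow> 'e \<Rightarrow> real) \<Rightarrow> ('p \<Rightarrow> 'e \<Rightarrow> 'e) \<Rightarrow> bool"
where
  "compatible M \<omega> J \<longleftrightarrow>
     (\<forall>p\<in>topspace (mtop M). \<forall>u v. assoc_metric \<omega> J p u v = assoc_metric \<omega> J p v u)"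

definition positive_compatible ::
  "('p, 'e::euclidean_space) manifold \<Rightarrow> ('p \<Rightarrow> 'e \<Rightarrow> 'e \<Rightarrow> real) \<Rightarrow> ('p \<Rightarrow> 'e \<Rightarrow> 'e) \<Rightarrow> bool"
where
  "positive_compatible M \<omega> J \<longleftrightarrow>
     compatible M \<omega> J \<and>
     (\<forall>p\<in>topspace (mtop M). \<forall>u. u \<noteq> 0 \<longrightarrow> assoc_metric \<omega> J p u u > 0)"

definition nijenhuis ::
  "('p, 'e::euclidean_space) manifold \<Rightarrow> ('p \<Rightarrow> 'e \<Rightarrow> 'e)
     \<Rightarrow> ('p \<Rightarrow> 'e) \<Rightarrow> ('p \<Rightarrow> 'e) \<Rightarrow> 'p \<Rightarrow> 'e"
where
  "nijenhuis M J X Y p =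
     (let JX = (\<lambda>q. J q (X q)); JY = (\<lambda>q. J q (Y q)) in
        lie_bracket M JX JY p - J p (lie_bracket M JX Y p)
      - J p (lie_bracket M X JY p) - lie_bracket M X Y p)"

text \<open>
  The value of the Nijenhuis tensor on two tangent vectors at \<open>p\<close> is its value on any vector fields
  extending them (it is tensorial, and every tangent vector extends to a global vector field).
\<close>

definition im_nijenhuis ::
  "('p, 'e::euclidean_space) manifold \<Rightarrow> ('p \<Rightarrow> 'e \<Rightarrow> 'e) \<Rightarrow> 'p \<Rightarrow> 'e set"
where
  "im_nijenhuis M J p =
     span {nijenhuis M J X Y p | X Y. vector_field M X \<and> vector_field M Y}"


section \<open>Distributions\<close>

definition constant_rank ::
  "('p, 'e::euclidean_space) manifold \<Rightarrow> ('p \<Rightarrow> 'e set) \<Rightarrow> nat \<Rightarrow> bool"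
where
  "constant_rank M D r \<longleftrightarrow>
     (\<forall>p\<in>topspace (mtop M). subspace (D p) \<and> dim (D p) = r)"

definition symp_orthogonal :: "('p \<Rightarrow> 'e \<Rightarrow> 'e \<Rightarrow> real) \<Rightarrow> ('p \<Rightarrow> 'e set) \<Rightarrow> 'p \<Rightarrow> 'e set" where
  "symp_orthogonal \<omega> D p = {v. \<forall>u\<in>D p. \<omega> p u v = 0}"

definition involutive :: "('p, 'e::euclidean_space) manifold \<Rightarrow> ('p \<Rightarrow> 'e set) \<Rightarrow> bool" where
  "involutive M D \<longleftrightarrow>
     (\<forall>X Y. vector_field M X \<and> vector_field M Y \<and>
        (\<forall>p\<in>topspace (mtop M). X p \<in> D p \<and> Y p \<in> D p) \<longrightarrow>
        (\<forall>p\<in>topspace (mtop M). lie_bracket M X Y p \<in> D p))"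


section \<open>Symplectic Lie groups\<close>

definition lie_group :: "('p, 'e::euclidean_space) manifold \<Rightarrow> 'p monoid \<Rightarrow> bool" where
  "lie_group M G \<longleftrightarrow>
     smooth_manifold M \<and> group G \<and> carrier G = topspace (mtop M) \<and>
     smooth_map (prod_manifold M M) M (\<lambda>(x, y). x \<otimes>\<^bsub>G\<^esub> y) \<and>
     smooth_map M M (\<lambda>x. inv\<^bsub>G\<^esub> x)"

definition left_invariant_form ::
  "('p, 'e::euclidean_space) manifold \<Rightarrow> 'p monoid \<Rightarrow> ('p \<Rightarrow> 'e \<Rightarrow> 'e \<Rightarrow> real) \<Rightarrow> bool"
where
  "left_invariant_form M G \<omega> \<longleftrightarrow>
     (\<forall>g\<in>carrier G. \<forall>x\<in>carrier G. \<forall>u v.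
        \<omega> (g \<otimes>\<^bsub>G\<^esub> x) (tangent_map M M (\<lambda>y. g \<otimes>\<^bsub>G\<^esub> y) x u) (tangent_map M M (\<lambda>y. g \<otimes>\<^bsub>G\<^esub> y) x v)
        = \<omega> x u v)"

definition left_invariant_endo ::
  "('p, 'e::euclidean_space) manifold \<Rightarrow> 'p monoid \<Rightarrow> ('p \<Rightarrow> 'e \<Rightarrow> 'e) \<Rightarrow> bool"
where
  "left_invariant_endo M G J \<longleftrightarrow>
     (\<forall>g\<in>carrier G. \<forall>x\<in>carrier G. \<forall>u.
        J (g \<otimes>\<^bsub>G\<^esub> x) (tangent_map M M (\<lambda>y. g \<otimes>\<^bsub>G\<^esub> y) x u)
        = tangent_map M M (\<lambda>y. g \<otimes>\<^bsub>G\<^esub> y) x (J x u))"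

definition symplectic_lie_group ::
  "('p, 'e::euclidean_space) manifold \<Rightarrow> 'p monoid \<Rightarrow> ('p \<Rightarrow> 'e \<Rightarrow> 'e \<Rightarrow> real) \<Rightarrow> bool"
where
  "symplectic_lie_group M G \<omega> \<longleftrightarrow>
     lie_group M G \<and> symplectic_form M \<omega> \<and> left_invariant_form M G \<omega>"

end

theory Submission
  imports Defs
begin

text \<open>
  All groups used live on the Euclidean space itself, with the group law \<open>x \<cdot> y = x + A x y\<close>, where
  the linear maps \<open>A x\<close> satisfy \<open>A (x + A x y) = A x \<circ> A y\<close> and \<open>A (- x)\<close> is the inverse of \<open>A x\<close>. Left
  translations are affine, the left invariant vector fields are \<open>z \<mapsto> A z v\<close>, and everything reduces
  to the Lie algebra \<open>[u, v] = a u v - a v u\<close> with \<open>a\<close> the derivative of \<open>A\<close> at \<open>0\<close>.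

  For \<open>k < n\<close> let \<open>x\<^sub>0\<close> act on its orthogonal complement by \<open>x\<^sub>1 \<mapsto> x\<^sub>1 + 2h y\<^sub>0\<close>, \<open>x\<^sub>i \<mapsto> x\<^sub>i\<close>,
  \<open>y\<^sub>i \<mapsto> - y\<^sub>i\<close> (\<open>1 \<le> i \<le> k\<close>) and \<open>y\<^sub>0 \<mapsto> l y\<^sub>0\<close>, where \<open>J x\<^sub>i = y\<^sub>i\<close>. Then \<open>Im N\<close> is spanned by
  \<open>x\<^sub>1 + h y\<^sub>0\<close>, \<open>y\<^sub>1 - h x\<^sub>0\<close> and the \<open>x\<^sub>i, y\<^sub>i\<close> with \<open>2 \<le> i \<le> k\<close>; it is a subalgebra iff \<open>h = 0\<close> or
  \<open>l = - 1\<close>, and its orthogonal is one iff \<open>h = 0\<close> or \<open>l - 1 = 2h\<^sup>2\<close>. For \<open>k = n \<ge> 3\<close> take the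
  nilpotent algebra with \<open>[x\<^sub>1, x\<^sub>2] = - 2 y\<^sub>0\<close>, \<open>[x\<^sub>2, x\<^sub>0] = y\<^sub>1\<close>, \<open>[x\<^sub>0, x\<^sub>1] = y\<^sub>2\<close> and
  \<open>[x\<^sub>0, x\<^sub>i] = y\<^sub>i\<close> for \<open>i \<ge> 3\<close>: here \<open>N(x\<^sub>i, x\<^sub>j) = - [x\<^sub>i, x\<^sub>j]\<close>, so that \<open>Im N\<close> is everything.
\<close>

section \<open>Smooth maps\<close>

text \<open>\<open>Ck_on\<close> is phrased with \<open>frechet_derivative\<close>, which is picked
  by a choice operator; uniqueness of derivatives lets any explicitly known derivative stand in for
  it.\<close>

lemma Ck_on_SucI:
  assumes "\<And>x. (f has_derivative f' x) (at x)" and "\<And>v. Ck_on k UNIV (\<lambda>x. f' x v)"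
  shows "Ck_on (Suc k) UNIV f"
proof -
  have "frechet_derivative f (at x) = f' x" for x
    using assms(1) frechet_derivative_at by metis
  then show ?thesis
    using assms by (auto simp: differentiable_def)
qed

lemma Ck_on_SucE:
  assumes "Ck_on (Suc k) UNIV f"
  shows "(f has_derivative frechet_derivative f (at x)) (at x)"
    and "Ck_on k UNIV (\<lambda>x. frechet_derivative f (at x) v)"
  using assms by (auto simp: frechet_derivative_works)

lemma Ck_on_SucD: "Ck_on (Suc k) UNIV f \<Longrightarrow> Ck_on k UNIV f"
proof (induction k arbitrary: f)
  case 0
  then show ?case
    by (auto intro!: differentiable_imp_continuous_on simp: differentiable_on_def)
next
  case (Suc k)
  show ?case
    by (rule Ck_on_SucI[OF Ck_on_SucE(1)[OF Suc.prems] Suc.IH[OF Ck_on_SucE(2)[OF Suc.prems]]])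
qed

lemma Ck_on_const: "Ck_on k UNIV (\<lambda>x. c)"
  by (induction k arbitrary: c) (auto intro!: Ck_on_SucI derivative_eq_intros)

lemma Ck_on_linear: "linear f \<Longrightarrow> Ck_on k UNIV f"
proof (cases k)
  case (Suc m)
  assume "linear f"
  show ?thesis
    unfolding Suc
    by (rule Ck_on_SucI[OF linear_imp_has_derivative[OF \<open>linear f\<close>] Ck_on_const])
qed (simp add: linear_continuous_on linear_conv_bounded_linear)

lemma Ck_on_add: "Ck_on k UNIV f \<Longrightarrow> Ck_on k UNIV g \<Longrightarrow> Ck_on k UNIV (\<lambda>x. f x + g x)"
proof (induction k arbitrary: f g)
  case (Suc k)
  note f' = Ck_on_SucE[OF Suc.prems(1)]
  note g' = Ck_on_SucE[OF Suc.prems(2)]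
  show ?case
    by (rule Ck_on_SucI[OF has_derivative_add[OF f'(1) g'(1)] Suc.IH[OF f'(2) g'(2)]])
qed (simp add: continuous_on_add)

lemma Ck_on_bilinear:
  assumes "bounded_bilinear b"
  shows "Ck_on k UNIV f \<Longrightarrow> Ck_on k UNIV g \<Longrightarrow> Ck_on k UNIV (\<lambda>x. b (f x) (g x))"
proof (induction k arbitrary: f g)
  case (Suc k)
  note f' = Ck_on_SucE[OF Suc.prems(1)]
  note g' = Ck_on_SucE[OF Suc.prems(2)]
  \<comment> \<open>By the Leibniz rule each map is paired with the derivative of the other, so each
    map itself is also needed one order lower.\<close>
  show ?case
    by (rule Ck_on_SucI[OF bounded_bilinear.FDERIV[OF assms f'(1) g'(1)]], rule Ck_on_add)
      (rule Suc.IH[OF Ck_on_SucD[OF Suc.prems(1)] g'(2)], rule Suc.IH[OF f'(2) Ck_on_SucD[OF Suc.prems(2)]])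
qed (simp add: bounded_bilinear.continuous_on[OF assms])

lemma Ck_on_compose_linear:
  fixes L :: "'a::euclidean_space \<Rightarrow> 'b::euclidean_space" and f :: "'b \<Rightarrow> 'c::euclidean_space"
  assumes "linear L"
  shows "Ck_on k UNIV f \<Longrightarrow> Ck_on k UNIV (\<lambda>x. f (L x))"
proof (induction k arbitrary: f)
  case 0
  then show ?case
    using assms by (auto intro: continuous_on_compose2 linear_continuous_on
        simp: linear_conv_bounded_linear)
next
  case (Suc k)
  note f' = Ck_on_SucE[OF Suc.prems(1)]
  show ?case
    by (rule Ck_on_SucI[OF has_derivative_compose[OF linear_imp_has_derivative[OF assms] f'(1)]])
      (rule Suc.IH[OF f'(2)])
qed

text \<open>The scalar \<open>r\<close> closes the family under differentiation: a derivative in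
  direction \<open>v\<close> only replaces \<open>r\<close> by \<open>r * l v\<close>.\<close>

lemma Ck_on_exp_linear:
  fixes l :: "'a::euclidean_space \<Rightarrow> real"
  assumes "linear l"
  shows "Ck_on k UNIV (\<lambda>x. r * exp (l x))"
proof (induction k arbitrary: r)
  case 0
  then show ?case
    using continuous_on_exp[OF linear_continuous_on[OF assms[unfolded linear_conv_bounded_linear]]]
    by (simp add: continuous_on_mult_left)
next
  case (Suc k)
  have "((\<lambda>x. r * exp (l x)) has_derivative (\<lambda>v. (r * l v) * exp (l x))) (at x)" for x
    by (rule has_derivative_eq_rhs[OF has_derivative_mult_right[OF has_derivative_exp[OF
            linear_imp_has_derivative[OF assms]]]]) (simp add: fun_eq_iff)
  then show ?case
    by (rule Ck_on_SucI[where f' = "\<lambda>x v. (r * l v) * exp (l x)"]) (rule Suc.IH)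
qed

section \<open>Closure properties of smooth maps\<close>

lemma smooth_on_const: "smooth_on UNIV (\<lambda>x. c)"
  by (simp add: smooth_on_def Ck_on_const)

lemma smooth_on_linear: "linear f \<Longrightarrow> smooth_on UNIV f"
  by (simp add: smooth_on_def Ck_on_linear)

lemma smooth_on_add:
  "smooth_on UNIV f \<Longrightarrow> smooth_on UNIV g \<Longrightarrow> smooth_on UNIV (\<lambda>x. f x + g x)"
  by (simp add: smooth_on_def Ck_on_add)

lemma smooth_on_bilinear:
  assumes "bounded_bilinear b" "smooth_on UNIV f" "smooth_on UNIV g"
  shows "smooth_on UNIV (\<lambda>x. b (f x) (g x))"
  using assms by (simp add: smooth_on_def Ck_on_bilinear)

lemmas smooth_on_scaleR = smooth_on_bilinear[OF bounded_bilinear_scaleR]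
lemmas smooth_on_inner = smooth_on_bilinear[OF bounded_bilinear_inner]
lemmas smooth_on_mult = smooth_on_bilinear[OF bounded_bilinear_mult]

lemma smooth_on_compose_linear:
  "linear L \<Longrightarrow> smooth_on UNIV f \<Longrightarrow> smooth_on UNIV (\<lambda>x. f (L x))"
  by (simp add: smooth_on_def Ck_on_compose_linear)

lemma smooth_on_exp_linear: "linear l \<Longrightarrow> smooth_on UNIV (\<lambda>x. exp (l x :: real))"
  using Ck_on_exp_linear[of l _ 1] by (simp add: smooth_on_def)

lemma smooth_on_sum:
  "(\<And>i. i \<in> I \<Longrightarrow> smooth_on UNIV (f i)) \<Longrightarrow> smooth_on UNIV (\<lambda>x. \<Sum>i\<in>I. f i x)"
  by (induction I rule: infinite_finite_induct) (auto intro: smooth_on_const smooth_on_add)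

lemma smooth_on_has_derivative:
  assumes "smooth_on UNIV f"
  shows "(f has_derivative frechet_derivative f (at x)) (at x)"
proof -
  have "Ck_on (Suc 0) UNIV f"
    using assms by (simp add: smooth_on_def)
  then show ?thesis
    by (simp add: frechet_derivative_works)
qed

lemma smooth_on_imp_continuous_on: "smooth_on UNIV f \<Longrightarrow> continuous_on UNIV f"
  unfolding smooth_on_def by (metis Ck_on.simps(1))

lemma smooth_on_linear_comp:
  assumes "linear L" "smooth_on UNIV f"
  shows "smooth_on UNIV (\<lambda>x. L (f x))"
proof -
  have "L (f x) = (\<Sum>b\<in>Basis. (f x \<bullet> b) *\<^sub>R L b)" for x
    using linear_sum[OF assms(1), of "\<lambda>b. (f x \<bullet> b) *\<^sub>R b" Basis]
    by (simp add: linear_scale[OF assms(1)] euclidean_representation)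
  then show ?thesis
    by (auto intro!: smooth_on_sum smooth_on_scaleR smooth_on_inner smooth_on_const assms)
qed

text \<open>Smoothness of the family is known for each fixed vector only; expanding
  \<open>f x\<close> in the orthonormal basis leaves a finite sum of scalar multiples of such
  maps.\<close>

lemma smooth_on_family_apply:
  assumes "\<And>x. linear (A x)" "\<And>v. smooth_on UNIV (\<lambda>x. A x v)" "smooth_on UNIV f"
  shows "smooth_on UNIV (\<lambda>x. A x (f x))"
proof -
  have "A x (f x) = (\<Sum>b\<in>Basis. (f x \<bullet> b) *\<^sub>R A x b)" for x
    using linear_sum[OF assms(1), of x "\<lambda>b. (f x \<bullet> b) *\<^sub>R b" Basis]
    by (simp add: linear_scale[OF assms(1)] euclidean_representation)
  then show ?thesis
    by (auto intro!: smooth_on_sum smooth_on_scaleR smooth_on_inner smooth_on_const assms)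
qed

text \<open>The product rule for evaluating a family of linear maps, by the same basis
  expansion.\<close>

lemma has_derivative_family_apply:
  fixes A :: "'a::euclidean_space \<Rightarrow> 'b::euclidean_space \<Rightarrow> 'c::euclidean_space"
  assumes "\<And>x. linear (A x)" and A': "\<And>v. ((\<lambda>x. A x v) has_derivative (\<lambda>u. A' u v)) (at x)"
    and "\<And>u. linear (A' u)" and f': "(f has_derivative f') (at x)"
  shows "((\<lambda>x. A x (f x)) has_derivative (\<lambda>u. A' u (f x) + A x (f' u))) (at x)"
proof -
  have expand: "L v = (\<Sum>b\<in>Basis. (v \<bullet> b) *\<^sub>R L b)" if "linear L" for L :: "'b \<Rightarrow> 'c" and v
    using linear_sum[OF that, of "\<lambda>b. (v \<bullet> b) *\<^sub>R b" Basis]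
    by (simp add: linear_scale[OF that] euclidean_representation)
  have "((\<lambda>x. \<Sum>b\<in>Basis. (f x \<bullet> b) *\<^sub>R A x b) has_derivative
      (\<lambda>u. \<Sum>b\<in>Basis. (f x \<bullet> b) *\<^sub>R A' u b + (f' u \<bullet> b) *\<^sub>R A x b)) (at x)"
    by (intro has_derivative_sum has_derivative_scaleR A' has_derivative_inner_left f')
  then show ?thesis
    by (simp add: expand[OF assms(1), symmetric] expand[OF assms(3), symmetric] sum.distrib)
qed

section \<open>The one-chart manifold\<close>

definition euclidean_manifold :: "('e::euclidean_space, 'e) manifold" where
  "euclidean_manifold = \<lparr>mtop = euclidean, atlas = {(UNIV, id)}\<rparr>"

text \<open>With a single chart the choice in \<open>chart_at\<close> is forced, so that tensor
  fields coincide with their expressions in that chart.\<close>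

lemma euclidean_manifold_simps [simp]:
  "mtop euclidean_manifold = euclidean"
  "atlas euclidean_manifold = {(UNIV, id)}"
  "chart_at euclidean_manifold p = (UNIV, id)"
  by (auto simp: euclidean_manifold_def chart_at_def intro!: some_equality)

lemma smooth_on_id [simp]: "smooth_on UNIV id"
  by (rule smooth_on_linear) (rule linear_id)

lemma frechet_derivative_id' [simp]: "frechet_derivative id (at x) = id"
  by (metis frechet_derivative_at has_derivative_id id_def)

lemma coords_euclidean [simp]:
  "coords euclidean_manifold (UNIV, id) p = id"
  "vec_of_coords euclidean_manifold (UNIV, id) p = id"
  by (simp_all add: coords_def vec_of_coords_def)

lemma local_vf_euclidean [simp]: "local_vf euclidean_manifold (UNIV, id) X = X"
  by (auto simp: local_vf_def)

lemma local_endo_euclidean [simp]: "local_endo euclidean_manifold (UNIV, id) J = J"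
  by (simp add: local_endo_def fun_eq_iff)

lemma local_form_euclidean [simp]: "local_form euclidean_manifold (UNIV, id) w = w"
  by (auto simp: local_form_def fun_eq_iff)

lemma vector_field_euclidean [simp]: "vector_field euclidean_manifold X \<longleftrightarrow> smooth_on UNIV X"
  by (simp add: vector_field_def)

lemma tangent_map_euclidean [simp]:
  "tangent_map euclidean_manifold euclidean_manifold f p = frechet_derivative f (at p)"
  by (simp add: tangent_map_def)

lemma lie_bracket_euclidean:
  assumes "(X has_derivative X') (at p)" "(Y has_derivative Y') (at p)"
  shows "lie_bracket euclidean_manifold X Y p = Y' (X p) - X' (Y p)"
  using assms by (simp add: lie_bracket_def frechet_derivative_at[symmetric])

lemma smooth_manifold_euclidean: "smooth_manifold euclidean_manifold"
proof -
  obtain \<B> :: "'a set set" where "countable \<B>" "topological_basis \<B>"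
    using ex_countable_basis by blast
  then have "second_countable (euclidean :: 'a topology)"
    unfolding second_countable_def open_openin[symmetric]
    by (intro exI[of _ \<B>]) (metis topological_basisE topological_basis_open)
  then show ?thesis
    by (auto simp: smooth_manifold_def)
qed

lemma smooth_map_euclidean:
  assumes "smooth_on UNIV f"
  shows "smooth_map euclidean_manifold euclidean_manifold f"
  using assms smooth_on_imp_continuous_on[OF assms] by (simp add: smooth_map_def)

lemma smooth_map_prod_euclidean:
  assumes "smooth_on UNIV f"
  shows "smooth_map (prod_manifold euclidean_manifold euclidean_manifold) euclidean_manifold f"
  using assms smooth_on_imp_continuous_on[OF assms]
  by (simp add: smooth_map_def prod_manifold_def map_prod.id)

text \<open>Every functional vanishing on \<open>D\<close> is constantly \<open>0\<close> along
  \<open>f\<close>, hence kills the derivative, and \<open>D\<close> is its own double orthogonal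
  complement.\<close>

lemma has_derivative_in_subspace:
  fixes f :: "'a::real_normed_vector \<Rightarrow> 'b::euclidean_space"
  assumes "(f has_derivative f') (at x)" and "subspace D" and "\<And>z. f z \<in> D"
  shows "f' u \<in> D"
proof -
  have "w \<bullet> f' u = 0" if "w \<in> D\<^sup>\<bottom>" for w
  proof -
    have "((\<lambda>z. w \<bullet> f z) has_derivative (\<lambda>u. w \<bullet> f' u)) (at x)"
      by (rule has_derivative_inner_right[OF assms(1)])
    moreover have "(\<lambda>z. w \<bullet> f z) = (\<lambda>z. 0)"
      using that assms(3) by (fastforce simp: orthogonal_comp_def orthogonal_def inner_commute)
    ultimately have "((\<lambda>z. 0) has_derivative (\<lambda>u. w \<bullet> f' u)) (at x)"
      by simp
    from has_derivative_unique[OF this has_derivative_const] show ?thesis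
      by (rule fun_cong)
  qed
  then have "f' u \<in> D\<^sup>\<bottom>\<^sup>\<bottom>"
    by (auto simp: orthogonal_comp_def orthogonal_def)
  then show ?thesis
    by (simp add: orthogonal_comp_self[OF assms(2)])
qed

section \<open>Affine Lie groups\<close>

text \<open>
  \<open>A x\<close> is the differential at the neutral element \<open>0\<close> of the left translation by \<open>x\<close>.
\<close>

locale affine_lie_group =
  fixes A a :: "'e::euclidean_space \<Rightarrow> 'e \<Rightarrow> 'e"
  assumes linear_A: "linear (A x)"
    and A_mult: "A (x + A x y) v = A x (A y v)"
    and A_minus [simp]: "A (- x) (A x v) = v"
    and smooth_A: "smooth_on UNIV (\<lambda>x. A x v)"
    and deriv_A: "((\<lambda>x. A x v) has_derivative (\<lambda>u. a u v)) (at 0)"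
begin

definition G :: "'e monoid" where
  "G = \<lparr>carrier = UNIV, mult = (\<lambda>x y. x + A x y), one = 0\<rparr>"

definition br :: "'e \<Rightarrow> 'e \<Rightarrow> 'e" where
  "br u v = a u v - a v u"

definition left_dist :: "'e set \<Rightarrow> 'e \<Rightarrow> 'e set" where
  "left_dist D x = A x ` D"

lemma G_simps [simp]: "carrier G = UNIV" "x \<otimes>\<^bsub>G\<^esub> y = x + A x y" "\<one>\<^bsub>G\<^esub> = 0"
  by (simp_all add: G_def)

lemma A_minus' [simp]: "A x (A (- x) v) = v"
  using A_minus[of "- x"] by simp

lemma A_0 [simp]: "A 0 v = v"
  using A_mult[of 0 0 v] A_minus[of 0 v] linear_0[OF linear_A] by simp

lemma inj_A: "inj (A x)"
  by (metis A_minus injI)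

text \<open>\<open>A (- z)\<close> inverts \<open>A z\<close>, and inverting a composite reverses
  the order.\<close>

lemma A_inverse_mult: "A (- (x + A x y)) v = A (- y) (A (- x) v)"
  by (metis A_minus A_minus' A_mult)

lemma left_inverse: "A (- x) (- x) \<otimes>\<^bsub>G\<^esub> x = \<one>\<^bsub>G\<^esub>"
proof -
  \<comment> \<open>The candidate \<open>y = A (- x) (- x)\<close> is the right inverse,
    \<open>x + A x y = 0\<close>; so \<open>A_mult\<close> makes \<open>A y\<close> the inverse of
    \<open>A x\<close>, which gives \<open>y + A y x = 0\<close>.\<close>
  have "A x (A (A (- x) (- x)) x) = A (x + A x (A (- x) (- x))) x"
    by (rule A_mult[symmetric])
  also have "\<dots> = x"
    by simp
  finally have "A (A (- x) (- x)) x = A (- x) x"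
    by (metis A_minus)
  then show ?thesis
    by (simp add: linear_neg[OF linear_A])
qed

lemma group_G: "group G"
proof (rule groupI)
  fix x
  show "\<exists>y\<in>carrier G. y \<otimes>\<^bsub>G\<^esub> x = \<one>\<^bsub>G\<^esub>"
    using left_inverse by auto
qed (auto simp: A_mult linear_add[OF linear_A] add.assoc)

lemma inv_G: "inv\<^bsub>G\<^esub> x = A (- x) (- x)"
  by (rule group.inv_equality[OF group_G left_inverse]) simp_all

lemma smooth_A_minus: "smooth_on UNIV (\<lambda>x. A (- x) v)"
  by (rule smooth_on_compose_linear[OF _ smooth_A]) (simp add: linear_iff)

lemma smooth_on_A_apply: "smooth_on UNIV f \<Longrightarrow> smooth_on UNIV (\<lambda>x. A x (f x))"
  by (rule smooth_on_family_apply[OF linear_A smooth_A])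

lemma lie_group_G: "lie_group euclidean_manifold G"
proof -
  have "smooth_on UNIV (\<lambda>p. A (fst p) v)" for v :: 'e
    by (rule smooth_on_compose_linear[OF linear_fst smooth_A])
  from smooth_on_add[OF smooth_on_linear[OF linear_fst]
      smooth_on_family_apply[OF linear_A this smooth_on_linear[OF linear_snd]]]
  have "smooth_on UNIV (\<lambda>(x, y). x \<otimes>\<^bsub>G\<^esub> y)"
    unfolding case_prod_beta G_simps .
  moreover have "smooth_on UNIV (\<lambda>x. inv\<^bsub>G\<^esub> x)"
    unfolding inv_G
    by (rule smooth_on_family_apply[OF linear_A smooth_A_minus smooth_on_linear[OF linear_uminus]])
  ultimately show ?thesis
    by (simp add: lie_group_def smooth_manifold_euclidean group_G smooth_map_euclidean
        smooth_map_prod_euclidean del: G_simps(2))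
qed

text \<open>Left translations are affine, so their differentials do not depend on the base point;
  left invariance becomes a condition on the linear maps \<open>A g\<close>.\<close>

lemma tangent_left_translation:
  "frechet_derivative (\<lambda>y. g \<otimes>\<^bsub>G\<^esub> y) (at x) = A g"
proof -
  have "((\<lambda>y. g + A g y) has_derivative A g) (at x)"
    using has_derivative_add[OF has_derivative_const linear_imp_has_derivative[OF linear_A]] by simp
  then show ?thesis
    by (simp add: frechet_derivative_at[symmetric])
qed

text \<open>Inherited from linearity of \<open>A x\<close> by differentiating at \<open>0\<close>,
  derivatives being unique.\<close>

lemma linear_a: "linear (a u)"
proof (rule linearI)
  fix v w :: 'e and r :: real
  have "((\<lambda>x. A x v + A x w) has_derivative (\<lambda>u. a u v + a u w)) (at 0)"
    by (intro has_derivative_add deriv_A)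
  then have "((\<lambda>x. A x (v + w)) has_derivative (\<lambda>u. a u v + a u w)) (at 0)"
    by (simp add: linear_add[OF linear_A])
  from has_derivative_unique[OF deriv_A this] show "a u (v + w) = a u v + a u w"
    by (rule fun_cong)
  have "((\<lambda>x. r *\<^sub>R A x v) has_derivative (\<lambda>u. r *\<^sub>R a u v)) (at 0)"
    by (intro has_derivative_scaleR_right deriv_A)
  then have "((\<lambda>x. A x (r *\<^sub>R v)) has_derivative (\<lambda>u. r *\<^sub>R a u v)) (at 0)"
    by (simp add: linear_scale[OF linear_A])
  from has_derivative_unique[OF deriv_A this] show "a u (r *\<^sub>R v) = r *\<^sub>R a u v"
    by (rule fun_cong)
qed

text \<open>The map is left translation by the group inverse of \<open>x\<close>; it moves
  \<open>x\<close> to \<open>0\<close>, where the derivative of \<open>A\<close> is given.\<close>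

lemma deriv_A_minus_shift: "((\<lambda>z. A (- x) (z - x)) has_derivative A (- x)) (at x)"
proof -
  have "((\<lambda>z. z - x) has_derivative (\<lambda>u. u)) (at x)"
    using has_derivative_diff[OF has_derivative_ident has_derivative_const] by simp
  from has_derivative_compose[OF this linear_imp_has_derivative[OF linear_A]] show ?thesis .
qed

text \<open>Writing \<open>z = x + A x y\<close> gives \<open>A z = A x \<circ> A y\<close>, and the
  differentiation takes place at \<open>y = 0\<close>.\<close>

lemma deriv_A_at: "((\<lambda>z. A z v) has_derivative (\<lambda>u. A x (a (A (- x) u) v))) (at x)"
proof -
  from has_derivative_compose[OF deriv_A_minus_shift, of "\<lambda>y. A y v" "\<lambda>u. a u v"]
  have "((\<lambda>z. A (A (- x) (z - x)) v) has_derivative (\<lambda>u. a (A (- x) u) v)) (at x)"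
    by (simp add: linear_0[OF linear_A] deriv_A)
  from has_derivative_compose[OF this linear_imp_has_derivative[OF linear_A[of x]]]
  have "((\<lambda>z. A x (A (A (- x) (z - x)) v)) has_derivative (\<lambda>u. A x (a (A (- x) u) v))) (at x)" .
  moreover have "A x (A (A (- x) (z - x)) v) = A z v" for z
    using A_mult[of x "A (- x) (z - x)" v] by simp
  ultimately show ?thesis
    by simp
qed

text \<open>For \<open>z = x + A x y\<close> the order is reversed,
  \<open>A (- z) = A (- y) \<circ> A (- x)\<close>, and again only \<open>y = 0\<close>
  matters.\<close>

lemma deriv_A_minus_at:
  "((\<lambda>z. A (- z) v) has_derivative (\<lambda>u. - a (A (- x) u) (A (- x) v))) (at x)"
proof -
  have 0: "((\<lambda>y. A (- y) w) has_derivative (\<lambda>u. - a u w)) (at 0)" for w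
  proof -
    have "linear (\<lambda>u. a u w)"
      by (metis deriv_A has_derivative_linear)
    then have "a (- u) w = - a u w" for u
      using linear_neg by fastforce
    then show ?thesis
      using has_derivative_compose[of uminus uminus 0 UNIV "\<lambda>y. A y w" "\<lambda>u. a u w"] deriv_A[of w]
      by (simp add: has_derivative_minus)
  qed
  from has_derivative_compose[OF deriv_A_minus_shift, of "\<lambda>y. A (- y) (A (- x) v)"
      "\<lambda>u. - a u (A (- x) v)"]
  have "((\<lambda>z. A (- A (- x) (z - x)) (A (- x) v)) has_derivative
      (\<lambda>u. - a (A (- x) u) (A (- x) v))) (at x)"
    by (simp add: linear_0[OF linear_A] 0)
  then show ?thesis
    by (simp add: A_inverse_mult[symmetric])
qed

section \<open>Brackets and distributions in a left invariant frame\<close>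

lemma deriv_left_frame:
  assumes "(\<xi> has_derivative \<xi>') (at x)"
  shows "((\<lambda>z. A z (\<xi> z)) has_derivative (\<lambda>u. A x (a (A (- x) u) (\<xi> x) + \<xi>' u))) (at x)"
  using has_derivative_family_apply[OF linear_A deriv_A_at _ assms]
    linear_compose[OF linear_a linear_A]
  by (simp add: o_def linear_add[OF linear_A])

text \<open>In the derivative of the frame, \<open>A (- x)\<close> cancels against the
  \<open>A x\<close> of the field inserted, which leaves the Lie algebra bracket of the
  components.\<close>

lemma lie_bracket_left_frame:
  assumes "(\<xi> has_derivative \<xi>') (at x)" "(\<eta> has_derivative \<eta>') (at x)"
  shows "lie_bracket euclidean_manifold (\<lambda>z. A z (\<xi> z)) (\<lambda>z. A z (\<eta> z)) x
    = A x (br (\<xi> x) (\<eta> x) + \<eta>' (A x (\<xi> x)) - \<xi>' (A x (\<eta> x)))"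
  by (subst lie_bracket_euclidean[OF deriv_left_frame[OF assms(1)] deriv_left_frame[OF assms(2)]])
    (simp add: br_def linear_add[OF linear_A] linear_diff[OF linear_A])

text \<open>The left invariant fields form a global smooth frame, so components are obtained by
  applying \<open>A (- z)\<close>.\<close>

lemma vector_field_left_frame:
  assumes "smooth_on UNIV X"
  obtains \<xi> \<xi>' where "\<And>z. X z = A z (\<xi> z)" "\<And>z. (\<xi> has_derivative \<xi>' z) (at z)"
proof -
  define \<xi> where "\<xi> z = A (- z) (X z)" for z
  have "smooth_on UNIV \<xi>"
    unfolding \<xi>_def
    by (rule smooth_on_family_apply[where A = "\<lambda>z. A (- z)"]) (rule linear_A smooth_A_minus assms)+
  then have "(\<xi> has_derivative frechet_derivative \<xi> (at z)) (at z)" for z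
    by (rule smooth_on_has_derivative)
  then show thesis
    using that[of \<xi> "\<lambda>z. frechet_derivative \<xi> (at z)"] by (simp add: \<xi>_def)
qed

lemma involutive_left_dist:
  assumes "subspace D"
  shows "involutive euclidean_manifold (left_dist D) \<longleftrightarrow> (\<forall>u\<in>D. \<forall>v\<in>D. br u v \<in> D)"
proof
  assume inv: "involutive euclidean_manifold (left_dist D)"
  show "\<forall>u\<in>D. \<forall>v\<in>D. br u v \<in> D"
  proof (intro ballI)
    fix u v assume "u \<in> D" "v \<in> D"
    \<comment> \<open>Constant components give left invariant fields, whose bracket at
      \<open>0\<close> is \<open>br u v\<close>.\<close>
    then have "lie_bracket euclidean_manifold (\<lambda>z. A z u) (\<lambda>z. A z v) 0 \<in> left_dist D 0"
      using inv[unfolded involutive_def, rule_format, of "\<lambda>z. A z u" "\<lambda>z. A z v" 0]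
      by (simp add: smooth_A left_dist_def)
    then show "br u v \<in> D"
      by (simp add: lie_bracket_left_frame[OF has_derivative_const has_derivative_const]
          left_dist_def)
  qed
next
  assume D: "\<forall>u\<in>D. \<forall>v\<in>D. br u v \<in> D"
  show "involutive euclidean_manifold (left_dist D)"
    unfolding involutive_def
  proof (intro allI impI ballI)
    fix X Y p
    assume XY: "vector_field euclidean_manifold X \<and> vector_field euclidean_manifold Y \<and>
      (\<forall>p\<in>topspace (mtop euclidean_manifold). X p \<in> left_dist D p \<and> Y p \<in> left_dist D p)"
    obtain \<xi> \<xi>' where \<xi>: "\<And>z. X z = A z (\<xi> z)" "\<And>z. (\<xi> has_derivative \<xi>' z) (at z)"
      using XY vector_field_left_frame[of X] by auto
    obtain \<eta> \<eta>' where \<eta>: "\<And>z. Y z = A z (\<eta> z)" "\<And>z. (\<eta> has_derivative \<eta>' z) (at z)"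
      using XY vector_field_left_frame[of Y] by auto
    have in_D: "\<xi> z \<in> D" "\<eta> z \<in> D" for z
      using XY by (auto simp: left_dist_def \<xi> \<eta> inj_image_mem_iff[OF inj_A])
    \<comment> \<open>The components stay in the fixed subspace \<open>D\<close>, hence so do their
      derivatives; only the term \<open>br\<close> needs the hypothesis on \<open>D\<close>.\<close>
    have "\<xi>' p u \<in> D" "\<eta>' p u \<in> D" for u
      using in_D \<xi>(2) \<eta>(2) has_derivative_in_subspace[OF _ assms] by (metis)+
    then have "br (\<xi> p) (\<eta> p) + \<eta>' p (A p (\<xi> p)) - \<xi>' p (A p (\<eta> p)) \<in> D"
      using in_D D by (intro subspace_diff subspace_add assms) auto
    moreover have "X = (\<lambda>z. A z (\<xi> z))" "Y = (\<lambda>z. A z (\<eta> z))"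
      using \<xi> \<eta> by auto
    ultimately show "lie_bracket euclidean_manifold X Y p \<in> left_dist D p"
      by (simp add: lie_bracket_left_frame[OF \<xi>(2) \<eta>(2)] left_dist_def)
  qed
qed

lemma dim_left_dist: "dim (left_dist D x) = dim D"
  unfolding left_dist_def by (rule dim_image_eq[OF linear_A inj_on_subset[OF inj_A]]) simp

lemma constant_rank_left_dist:
  "subspace D \<Longrightarrow> constant_rank euclidean_manifold (left_dist D) (dim D)"
  by (simp add: constant_rank_def dim_left_dist) (simp add: left_dist_def linear_subspace_image linear_A)

end

section \<open>Left invariant symplectic forms and almost complex structures\<close>

locale affine_symplectic_group = affine_lie_group +
  fixes J :: "'a \<Rightarrow> 'a"
  assumes linear_J: "linear J" and J_J [simp]: "J (J u) = - u"
    and inner_J_J [simp]: "J u \<bullet> J v = u \<bullet> v"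
    and closed: "J (br u v) \<bullet> w + J (br v w) \<bullet> u + J (br w u) \<bullet> v = 0"
begin

text \<open>Chosen so that \<open>assoc_metric\<close> is the left translated Euclidean inner
  product, which makes compatibility and positivity immediate.\<close>

definition \<omega> :: "'a \<Rightarrow> 'a \<Rightarrow> 'a \<Rightarrow> real" where
  "\<omega> x u v = J (A (- x) u) \<bullet> A (- x) v"

definition JJ :: "'a \<Rightarrow> 'a \<Rightarrow> 'a" where
  "JJ x u = A x (J (A (- x) u))"

definition nij :: "'a \<Rightarrow> 'a \<Rightarrow> 'a" where
  "nij u v = br (J u) (J v) - J (br (J u) v) - J (br u (J v)) - br u v"

lemma inner_J: "J u \<bullet> v = - (u \<bullet> J v)"
  using inner_J_J[of u "J v"] by simp

lemma smooth_\<omega>: "smooth_on UNIV (\<lambda>x. \<omega> x u v)"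
  unfolding \<omega>_def
  by (intro smooth_on_inner smooth_on_linear_comp[OF linear_J] smooth_A_minus)

lemma smooth_JJ: "smooth_on UNIV (\<lambda>x. JJ x u)"
  unfolding JJ_def
  by (intro smooth_on_A_apply smooth_on_linear_comp[OF linear_J] smooth_A_minus)

lemma deriv_\<omega>:
  "((\<lambda>z. \<omega> z v w) has_derivative
    (\<lambda>u. - (J (a (A (- x) u) (A (- x) v)) \<bullet> A (- x) w)
       - J (A (- x) v) \<bullet> a (A (- x) u) (A (- x) w))) (at x)"
proof -
  have "((\<lambda>z. J (A (- z) v)) has_derivative (\<lambda>u. J (- a (A (- x) u) (A (- x) v)))) (at x)"
    by (rule has_derivative_compose[OF deriv_A_minus_at linear_imp_has_derivative[OF linear_J]])
  from has_derivative_inner[OF this deriv_A_minus_at] show ?thesis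
    unfolding \<omega>_def
    by (rule has_derivative_eq_rhs) (simp add: linear_neg[OF linear_J] fun_eq_iff)
qed

text \<open>In left translated arguments the exterior derivative is minus the cyclic sum in
  \<open>closed\<close>, the cocycle condition on the Lie algebra.\<close>

lemma closed_\<omega>: "closed_form euclidean_manifold \<omega>"
proof -
  have "ext_deriv euclidean_manifold (UNIV, id) \<omega> x u v w = 0" for x u v w
  proof -
    have skew: "J p \<bullet> q = - (J q \<bullet> p)" for p q
      by (metis inner_J inner_commute)
    define u' v' w' where uvw: "u' = A (- x) u" "v' = A (- x) v" "w' = A (- x) w"
    show ?thesis
      using closed[of u' v' w'] skew[of v' "a u' w'"] skew[of u' "a v' w'"] skew[of u' "a w' v'"]
      unfolding ext_deriv_def local_form_euclidean frechet_derivative_at[OF deriv_\<omega>, symmetric]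
        br_def linear_diff[OF linear_J] inner_diff_left uvw by linarith
  qed
  then show ?thesis
    by (simp add: closed_form_def)
qed

lemma symplectic_lie_group_\<omega>: "symplectic_lie_group euclidean_manifold G \<omega>"
proof -
  have "bilinear (\<omega> x)" for x
    by (auto intro!: linearI simp: bilinear_def \<omega>_def linear_add[OF linear_A] linear_add[OF linear_J]
        linear_scale[OF linear_A] linear_scale[OF linear_J] inner_left_distrib inner_right_distrib)
  moreover have "\<omega> x u u = 0" for x u
    using inner_J[of "A (- x) u" "A (- x) u"] by (simp add: \<omega>_def inner_commute)
  moreover have "u = 0" if "\<And>v. \<omega> x u v = 0" for x u
  proof -
    \<comment> \<open>Nondegeneracy: pairing \<open>u\<close> with this \<open>v\<close> gives the
      squared norm of \<open>A (- x) u\<close>.\<close>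
    have "J (A (- x) u) \<bullet> J (A (- x) u) = 0"
      using that[of "A x (J (A (- x) u))"] by (simp add: \<omega>_def del: inner_J_J)
    then show ?thesis
      by (metis inner_J_J A_minus' inner_eq_zero_iff linear_0 linear_A)
  qed
  moreover have "left_invariant_form euclidean_manifold G \<omega>"
    unfolding left_invariant_form_def tangent_map_euclidean tangent_left_translation
    by (simp add: \<omega>_def A_inverse_mult del: minus_add_distrib)
  ultimately show ?thesis
    by (simp add: symplectic_lie_group_def lie_group_G symplectic_form_def two_form_def
        closed_\<omega> smooth_\<omega>) blast
qed

lemma almost_complex_JJ: "almost_complex euclidean_manifold JJ"
proof -
  have "linear (JJ x)" for x
    by (auto intro!: linearI simp: JJ_def linear_add[OF linear_A] linear_add[OF linear_J]
        linear_scale[OF linear_A] linear_scale[OF linear_J])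
  then show ?thesis
    by (auto simp: almost_complex_def endo_field_def smooth_JJ)
      (simp add: JJ_def linear_neg[OF linear_A])
qed

lemma left_invariant_JJ: "left_invariant_endo euclidean_manifold G JJ"
  unfolding left_invariant_endo_def tangent_map_euclidean tangent_left_translation
  by (simp add: JJ_def A_inverse_mult A_mult del: minus_add_distrib)

lemma positive_compatible_JJ: "positive_compatible euclidean_manifold \<omega> JJ"
proof -
  have "assoc_metric \<omega> JJ x u v = A (- x) u \<bullet> A (- x) v" for x u v
    by (simp add: assoc_metric_def \<omega>_def JJ_def)
  moreover have "A (- x) u \<noteq> 0" if "u \<noteq> 0" for x u
    using that by (metis A_minus' linear_0 linear_A)
  ultimately show ?thesis
    by (auto simp: positive_compatible_def compatible_def inner_commute)
qed

text \<open>
  Tensoriality: in \<open>N(X, Y)\<close> all terms involving derivatives of the components of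
  \<open>X\<close> and \<open>Y\<close> cancel.
\<close>

lemma nijenhuis_left_frame:
  assumes "\<And>z. (\<xi> has_derivative \<xi>' z) (at z)" "\<And>z. (\<eta> has_derivative \<eta>' z) (at z)"
  shows "nijenhuis euclidean_manifold JJ (\<lambda>z. A z (\<xi> z)) (\<lambda>z. A z (\<eta> z)) x
    = A x (nij (\<xi> x) (\<eta> x))"
proof -
  note J' = has_derivative_compose[OF _ linear_imp_has_derivative[OF linear_J]]
  show ?thesis
    unfolding nijenhuis_def JJ_def Let_def A_minus
      lie_bracket_left_frame[OF J'[OF assms(1)] J'[OF assms(2)]]
      lie_bracket_left_frame[OF J'[OF assms(1)] assms(2)]
      lie_bracket_left_frame[OF assms(1) J'[OF assms(2)]]
      lie_bracket_left_frame[OF assms(1) assms(2)]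
    by (simp add: nij_def linear_diff[OF linear_A] linear_add[OF linear_A] linear_diff[OF linear_J]
        linear_add[OF linear_J] linear_neg[OF linear_A])
qed

text \<open>By tensoriality arbitrary fields yield no more values than left invariant ones, and
  spans commute with the linear map \<open>A x\<close>.\<close>

lemma im_nijenhuis_JJ:
  "im_nijenhuis euclidean_manifold JJ = left_dist (span {nij u v | u v. True})"
proof
  fix x
  have "{nijenhuis euclidean_manifold JJ X Y x | X Y. smooth_on UNIV X \<and> smooth_on UNIV Y}
    = A x ` {nij u v | u v. True}" (is "?L = ?R")
  proof
    show "?L \<subseteq> ?R"
    proof
      fix w assume "w \<in> ?L"
      then obtain X Y where w: "w = nijenhuis euclidean_manifold JJ X Y x"
        and XY: "smooth_on UNIV X" "smooth_on UNIV Y" by blast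
      obtain \<xi> \<xi>' where \<xi>: "\<And>z. X z = A z (\<xi> z)" "\<And>z. (\<xi> has_derivative \<xi>' z) (at z)"
        using XY vector_field_left_frame[of X] by auto
      obtain \<eta> \<eta>' where \<eta>: "\<And>z. Y z = A z (\<eta> z)" "\<And>z. (\<eta> has_derivative \<eta>' z) (at z)"
        using XY vector_field_left_frame[of Y] by auto
      have "X = (\<lambda>z. A z (\<xi> z))" "Y = (\<lambda>z. A z (\<eta> z))"
        using \<xi> \<eta> by auto
      then show "w \<in> ?R"
        using w nijenhuis_left_frame[OF \<xi>(2) \<eta>(2)] by auto
    qed
    show "?R \<subseteq> ?L"
    proof
      fix w assume "w \<in> ?R"
      then obtain u v where "w = A x (nij u v)" by blast
      then have "w = nijenhuis euclidean_manifold JJ (\<lambda>z. A z u) (\<lambda>z. A z v) x"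
        by (simp add: nijenhuis_left_frame[OF has_derivative_const has_derivative_const])
      then show "w \<in> ?L"
        using smooth_A by blast
    qed
  qed
  then show "im_nijenhuis euclidean_manifold JJ x = left_dist (span {nij u v | u v. True}) x"
    by (simp add: im_nijenhuis_def left_dist_def linear_span_image[OF linear_A])
qed

lemma symp_orthogonal_left_dist:
  "symp_orthogonal \<omega> (left_dist D) = left_dist {v. \<forall>u\<in>D. J u \<bullet> v = 0}"
proof
  fix x
  have "v \<in> A x ` E \<longleftrightarrow> A (- x) v \<in> E" for v E
    by (metis A_minus' inj_A inj_image_mem_iff)
  then show "symp_orthogonal \<omega> (left_dist D) x = left_dist {v. \<forall>u\<in>D. J u \<bullet> v = 0} x"
    by (auto simp: symp_orthogonal_def left_dist_def \<omega>_def)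
qed

end

section \<open>Two families of symplectic Lie groups\<close>

locale symplectic_basis =
  fixes n :: nat and x y :: "nat \<Rightarrow> 'e::euclidean_space"
  assumes Basis_eq: "Basis = x ` {..<n} \<union> y ` {..<n}"
    and inj_x: "inj_on x {..<n}" and inj_y: "inj_on y {..<n}"
    and disjoint: "x ` {..<n} \<inter> y ` {..<n} = {}"
begin

definition comb :: "(nat \<Rightarrow> real) \<Rightarrow> (nat \<Rightarrow> real) \<Rightarrow> 'e" where
  "comb a b = (\<Sum>i<n. a i *\<^sub>R x i + b i *\<^sub>R y i)"

definition J :: "'e \<Rightarrow> 'e" where
  "J v = comb (\<lambda>i. - (v \<bullet> y i)) (\<lambda>i. v \<bullet> x i)"

lemma x_Basis: "i < n \<Longrightarrow> x i \<in> Basis" and y_Basis: "i < n \<Longrightarrow> y i \<in> Basis"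
  by (auto simp: Basis_eq)

lemma inner_basis [simp]:
  assumes "i < n" "j < n"
  shows "x i \<bullet> x j = (if i = j then 1 else 0)" "y i \<bullet> y j = (if i = j then 1 else 0)"
    "x i \<bullet> y j = 0" "y i \<bullet> x j = 0"
  using assms disjoint
  by (auto simp: inner_Basis x_Basis y_Basis inj_on_eq_iff[OF inj_x] inj_on_eq_iff[OF inj_y])

lemma inner_comb [simp]:
  assumes "j < n"
  shows "comb a b \<bullet> x j = a j" "comb a b \<bullet> y j = b j"
  using assms
  by (simp_all add: comb_def inner_sum_left inner_left_distrib if_distrib[of "\<lambda>t. _ * t"] sum.delta
      cong: if_cong)

lemma inner_J_basis [simp]:
  assumes "j < n"
  shows "J v \<bullet> x j = - (v \<bullet> y j)" "J v \<bullet> y j = v \<bullet> x j"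
  using assms by (simp_all add: J_def)

lemma coordinates_eqI:
  assumes "\<And>i. i < n \<Longrightarrow> u \<bullet> x i = v \<bullet> x i" "\<And>i. i < n \<Longrightarrow> u \<bullet> y i = v \<bullet> y i"
  shows "u = v"
  by (rule euclidean_eqI) (use assms in \<open>auto simp: Basis_eq\<close>)

lemma inner_eq_sum: "u \<bullet> v = (\<Sum>i<n. (u \<bullet> x i) * (v \<bullet> x i) + (u \<bullet> y i) * (v \<bullet> y i))"
proof -
  have "u \<bullet> v = (\<Sum>b\<in>x ` {..<n} \<union> y ` {..<n}. (u \<bullet> b) * (v \<bullet> b))"
    by (subst euclidean_inner) (simp only: Basis_eq)
  also have "\<dots> = (\<Sum>i<n. (u \<bullet> x i) * (v \<bullet> x i)) + (\<Sum>i<n. (u \<bullet> y i) * (v \<bullet> y i))"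
    by (simp add: sum.union_disjoint disjoint sum.reindex inj_x inj_y)
  finally show ?thesis
    by (simp add: sum.distrib)
qed

lemma linear_J: "linear J"
  by (intro linearI coordinates_eqI) (simp_all add: inner_left_distrib)

lemma J_J: "J (J u) = - u"
  by (rule coordinates_eqI) simp_all

lemma inner_J_J: "J u \<bullet> J v = u \<bullet> v"
proof -
  have "J u \<bullet> J v = (\<Sum>i<n. (u \<bullet> x i) * (v \<bullet> x i) + (u \<bullet> y i) * (v \<bullet> y i))"
    unfolding inner_eq_sum[of "J u" "J v"] by (rule sum.cong) simp_all
  then show ?thesis
    unfolding inner_eq_sum[of u v] .
qed

lemma inner_J_eq_sum: "J u \<bullet> v = (\<Sum>i<n. (u \<bullet> x i) * (v \<bullet> y i) - (u \<bullet> y i) * (v \<bullet> x i))"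
  unfolding inner_eq_sum[of "J u" v] by (rule sum.cong) simp_all

lemma smooth_on_comb:
  assumes "\<And>i. smooth_on UNIV (\<lambda>z. a z i)" "\<And>i. smooth_on UNIV (\<lambda>z. b z i)"
  shows "smooth_on UNIV (\<lambda>z. comb (a z) (b z))"
  unfolding comb_def
  by (rule smooth_on_sum)
    (rule smooth_on_add[OF smooth_on_scaleR[OF assms(1) smooth_on_const]
        smooth_on_scaleR[OF assms(2) smooth_on_const]])

lemma has_derivative_comb:
  assumes "\<And>i. ((\<lambda>z. a z i) has_derivative (\<lambda>u. a' u i)) F"
    and "\<And>i. ((\<lambda>z. b z i) has_derivative (\<lambda>u. b' u i)) F"
  shows "((\<lambda>z. comb (a z) (b z)) has_derivative (\<lambda>u. comb (a' u) (b' u))) F"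
  unfolding comb_def
  by (rule has_derivative_sum)
    (rule has_derivative_add[OF has_derivative_scaleR_left[OF assms(1)]
        has_derivative_scaleR_left[OF assms(2)]])

end

text \<open>
  The semidirect product of the line through \<open>x 0\<close> with its orthogonal complement,
  on which \<open>x 0\<close> acts by the derivation \<open>D\<close>; the exponential of \<open>t D\<close> is \<open>A (t x 0)\<close>.
\<close>

locale almost_abelian = symplectic_basis n x y
  for n and x y :: "nat \<Rightarrow> 'e::euclidean_space" +
  fixes k :: nat and l h :: real
  assumes n_ge: "n \<ge> 2" and k_less: "k < n" and l_neq: "l \<noteq> 1" and h_0: "k = 0 \<Longrightarrow> h = 0"
begin

definition p :: "nat \<Rightarrow> real" where
  "p i = (if 1 \<le> i \<and> i \<le> k then 1 else 0)"

text \<open>Opposite weights on \<open>x i\<close> and \<open>y i\<close> keep the action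
  infinitesimally symplectic for \<open>i \<ge> 1\<close>; the weight \<open>l\<close> on
  \<open>y 0\<close> is free because \<open>y 0\<close> is paired with the acting direction
  \<open>x 0\<close>.\<close>

definition q :: "nat \<Rightarrow> real" where
  "q i = (if i = 0 then l else - p i)"

text \<open>Chosen such that the off-diagonal entry of \<open>D\<close> is \<open>2 * h\<close>.\<close>

definition r :: real where
  "r = 2 * h / (l - 1)"

definition D :: "'e \<Rightarrow> 'e" where
  "D v = comb (\<lambda>i. p i * (v \<bullet> x i)) (\<lambda>i. q i * (v \<bullet> y i) + (if i = 0 then 2 * h * (v \<bullet> x 1) else 0))"

definition A :: "'e \<Rightarrow> 'e \<Rightarrow> 'e" where
  "A z v = comb (\<lambda>i. exp (p i * (z \<bullet> x 0)) * (v \<bullet> x i))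
    (\<lambda>i. exp (q i * (z \<bullet> x 0)) * (v \<bullet> y i) +
      (if i = 0 then r * (exp (l * (z \<bullet> x 0)) - exp (p 1 * (z \<bullet> x 0))) * (v \<bullet> x 1)
       else 0))"

lemma n_pos [simp]: "0 < n" "Suc 0 < n"
  using n_ge by auto

lemma inner_A [simp]:
  assumes "i < n"
  shows "A z v \<bullet> x i = exp (p i * (z \<bullet> x 0)) * (v \<bullet> x i)"
    "A z v \<bullet> y i = exp (q i * (z \<bullet> x 0)) * (v \<bullet> y i) +
      (if i = 0 then r * (exp (l * (z \<bullet> x 0)) - exp (p 1 * (z \<bullet> x 0))) * (v \<bullet> x 1)
       else 0)"
  using assms by (simp_all add: A_def)

lemma inner_D [simp]:
  assumes "i < n"
  shows "D v \<bullet> x i = p i * (v \<bullet> x i)"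
    "D v \<bullet> y i = q i * (v \<bullet> y i) + (if i = 0 then 2 * h * (v \<bullet> x 1) else 0)"
  using assms by (simp_all add: D_def)

lemma p_0 [simp]: "p 0 = 0" and q_0 [simp]: "q 0 = l"
  by (simp_all add: p_def q_def)

text \<open>\<open>A z\<close> depends only on \<open>z \<bullet> x 0\<close> and is a one-parameter
  group in it; since \<open>p 0 = 0\<close>, this coordinate is additive under the group
  law.\<close>

lemma A_add: "t = z \<bullet> x 0 + w \<bullet> x 0 \<Longrightarrow> s \<bullet> x 0 = t \<Longrightarrow> A s v = A z (A w v)"
  by (rule coordinates_eqI) (auto simp: exp_add ring_distribs)

lemma A_zero: "z \<bullet> x 0 = 0 \<Longrightarrow> A z v = v"
  by (rule coordinates_eqI) auto

lemma has_derivative_A: "((\<lambda>z. A z v) has_derivative (\<lambda>u. (u \<bullet> x 0) *\<^sub>R D v)) (at 0)"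
proof -
  have e: "((\<lambda>z. exp (c * (z \<bullet> x 0))) has_derivative (\<lambda>u. c * (u \<bullet> x 0))) (at 0)" for c :: real
    by (auto intro!: derivative_eq_intros)
  \<comment> \<open>For \<open>0 < k\<close> the weight \<open>p 1\<close> is \<open>1\<close> and
    the denominator of \<open>r\<close> cancels; for \<open>k = 0\<close> both sides vanish by
    \<open>h_0\<close>.\<close>
  have h: "r * (l - p 1) = 2 * h"
  proof (cases "k = 0")
    case True
    then show ?thesis
      using h_0 unfolding r_def by simp
  qed (use l_neq in \<open>simp add: p_def r_def\<close>)
  have "((\<lambda>z. A z v) has_derivative (\<lambda>u. comb (\<lambda>i. p i * (u \<bullet> x 0) * (v \<bullet> x i))
      (\<lambda>i. q i * (u \<bullet> x 0) * (v \<bullet> y i) + (if i = 0 then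
        r * (l * (u \<bullet> x 0) - p 1 * (u \<bullet> x 0)) * (v \<bullet> x 1) else 0)))) (at 0)"
    unfolding A_def
  proof (rule has_derivative_comb)
    fix i
    show "((\<lambda>z. exp (p i * (z \<bullet> x 0)) * (v \<bullet> x i)) has_derivative
        (\<lambda>u. p i * (u \<bullet> x 0) * (v \<bullet> x i))) (at 0)"
      by (rule has_derivative_mult_left[OF e])
    have "((\<lambda>z. if i = 0 then r * (exp (l * (z \<bullet> x 0)) - exp (p 1 * (z \<bullet> x 0)))
          * (v \<bullet> x 1) else 0) has_derivative
        (\<lambda>u. if i = 0 then r * (l * (u \<bullet> x 0) - p 1 * (u \<bullet> x 0)) * (v \<bullet> x 1) else 0))
        (at 0)"
      by (cases "i = 0") (simp_all only: simp_thms if_True if_False has_derivative_const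
          has_derivative_mult_left[OF has_derivative_mult_right[OF has_derivative_diff[OF e e]]])
    from has_derivative_add[OF has_derivative_mult_left[OF e] this]
    show "((\<lambda>z. exp (q i * (z \<bullet> x 0)) * (v \<bullet> y i) +
          (if i = 0 then r * (exp (l * (z \<bullet> x 0)) - exp (p 1 * (z \<bullet> x 0)))
            * (v \<bullet> x 1) else 0)) has_derivative
        (\<lambda>u. q i * (u \<bullet> x 0) * (v \<bullet> y i) + (if i = 0 then
          r * (l * (u \<bullet> x 0) - p 1 * (u \<bullet> x 0)) * (v \<bullet> x 1) else 0))) (at 0)" .
  qed
  then show ?thesis
  proof (rule has_derivative_eq_rhs, intro ext coordinates_eqI)
    fix u i assume "i < n"
    have "r * (l * t - p 1 * t) = 2 * h * t" for t
      using h by (metis mult.assoc left_diff_distrib)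
    then show "comb (\<lambda>i. p i * (u \<bullet> x 0) * (v \<bullet> x i))
      (\<lambda>i. q i * (u \<bullet> x 0) * (v \<bullet> y i) + (if i = 0 then
        r * (l * (u \<bullet> x 0) - p 1 * (u \<bullet> x 0)) * (v \<bullet> x 1) else 0)) \<bullet> y i
      = (u \<bullet> x 0) *\<^sub>R D v \<bullet> y i"
      using \<open>i < n\<close> by (simp only: inner_comb) (simp add: algebra_simps)
  qed simp
qed

lemma smooth_on_A: "smooth_on UNIV (\<lambda>z. A z v)"
proof -
  have e: "smooth_on UNIV (\<lambda>z. exp (c * (z \<bullet> x 0)))" for c :: real
    by (rule smooth_on_exp_linear) (auto intro!: linearI simp: inner_left_distrib algebra_simps)
  have "smooth_on UNIV (\<lambda>z. exp (c * (z \<bullet> x 0)) + - 1 * exp (d * (z \<bullet> x 0)))" for c d :: real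
    by (rule smooth_on_add[OF e smooth_on_mult[OF smooth_on_const e]])
  then have e2: "smooth_on UNIV (\<lambda>z. exp (c * (z \<bullet> x 0)) - exp (d * (z \<bullet> x 0)))" for c d :: real
    by simp
  show ?thesis
    unfolding A_def
  proof (rule smooth_on_comb)
    fix i
    show "smooth_on UNIV (\<lambda>z. exp (p i * (z \<bullet> x 0)) * (v \<bullet> x i))"
      by (rule smooth_on_mult[OF e smooth_on_const])
    have "smooth_on UNIV (\<lambda>z. if i = 0 then r * (exp (l * (z \<bullet> x 0)) - exp (p 1 * (z \<bullet> x 0))) * (v \<bullet> x 1) else 0)"
      by (cases "i = 0") (simp_all only: simp_thms if_True if_False smooth_on_const
        smooth_on_mult[OF smooth_on_mult[OF smooth_on_const e2] smooth_on_const])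
    from smooth_on_add[OF smooth_on_mult[OF e smooth_on_const] this]
    show "smooth_on UNIV (\<lambda>z. exp (q i * (z \<bullet> x 0)) * (v \<bullet> y i) +
      (if i = 0 then r * (exp (l * (z \<bullet> x 0)) - exp (p 1 * (z \<bullet> x 0))) * (v \<bullet> x 1)
       else 0))" .
  qed
qed

sublocale affine_lie_group A "\<lambda>u v. (u \<bullet> x 0) *\<^sub>R D v"
proof (rule affine_lie_group.intro)
  show "linear (A z)" for z
    by (intro linearI coordinates_eqI) (auto simp: inner_left_distrib algebra_simps)
  show "A (z + A z w) v = A z (A w v)" for z w v
    by (rule A_add) (simp_all add: inner_left_distrib)
  show "A (- z) (A z v) = v" for z v
  proof -
    have "A 0 v = A (- z) (A z v)"
      by (rule A_add) simp_all
    then show ?thesis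
      by (simp add: A_zero)
  qed
qed (rule smooth_on_A has_derivative_A)+

lemma inner_br [simp]:
  assumes "i < n"
  shows "br u v \<bullet> x i = (u \<bullet> x 0) * (D v \<bullet> x i) - (v \<bullet> x 0) * (D u \<bullet> x i)"
    "br u v \<bullet> y i = (u \<bullet> x 0) * (D v \<bullet> y i) - (v \<bullet> x 0) * (D u \<bullet> y i)"
  by (simp_all add: br_def inner_diff_left)

text \<open>
  Up to a term symmetric in \<open>v\<close> and \<open>w\<close>, which expresses that \<open>D\<close> is
  infinitesimally symplectic, only the coordinates with index \<open>0\<close> contribute.
\<close>

lemma inner_J_D:
  "J (D v) \<bullet> w = (\<Sum>i<n. p i * ((v \<bullet> x i) * (w \<bullet> y i) + (v \<bullet> y i) * (w \<bullet> x i)))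
    - (l * (v \<bullet> y 0) + 2 * h * (v \<bullet> x 1)) * (w \<bullet> x 0)"
proof -
  have "J (D v) \<bullet> w = (\<Sum>i<n. p i * ((v \<bullet> x i) * (w \<bullet> y i) + (v \<bullet> y i) * (w \<bullet> x i))
      - (if i = 0 then (l * (v \<bullet> y 0) + 2 * h * (v \<bullet> x 1)) * (w \<bullet> x 0) else 0))"
    unfolding inner_J_eq_sum by (rule sum.cong) (auto simp: q_def algebra_simps)
  then show ?thesis
    by (simp add: sum_subtractf)
qed

sublocale affine_symplectic_group A "\<lambda>u v. (u \<bullet> x 0) *\<^sub>R D v" J
proof (rule affine_symplectic_group.intro[OF affine_lie_group_axioms],
    rule affine_symplectic_group_axioms.intro)
  fix u v w
  define s where "s v w = (\<Sum>i<n. p i * ((v \<bullet> x i) * (w \<bullet> y i) + (v \<bullet> y i) * (w \<bullet> x i)))" for v w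
  have s: "s v w = s w v" for v w
    unfolding s_def by (rule sum.cong) (simp_all add: algebra_simps)
  \<comment> \<open>The symmetric parts cancel in pairs, and so do the remaining terms, each with a
    product of two \<open>x 0\<close>-coordinates.\<close>
  show "J (br u v) \<bullet> w + J (br v w) \<bullet> u + J (br w u) \<bullet> v = 0"
    unfolding br_def linear_diff[OF linear_J] linear_scale[OF linear_J] inner_diff_left
      inner_scaleR_left inner_J_D s_def[symmetric]
    using s[of u v] s[of v w] s[of u w] by (simp add: algebra_simps)
qed (rule linear_J J_J inner_J_J)+

section \<open>Image of the Nijenhuis tensor and its orthogonal complement for
  \<open>k < n\<close>\<close>

definition N :: "'e set" where
  "N = {v. (\<forall>i<n. k < i \<longrightarrow> v \<bullet> x i = 0 \<and> v \<bullet> y i = 0) \<and>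
    v \<bullet> y 0 = h * (v \<bullet> x 1) \<and> v \<bullet> x 0 = - h * (v \<bullet> y 1)}"

text \<open>The equations express orthogonality to the spanning vectors of \<open>N\<close>, among
  which \<open>x 1 + h y 0\<close> and \<open>y 1 - h x 0\<close> require
  \<open>0 < k\<close>.\<close>

definition N_perp :: "'e set" where
  "N_perp = {v. (\<forall>i. 2 \<le> i \<and> i \<le> k \<longrightarrow> v \<bullet> x i = 0 \<and> v \<bullet> y i = 0) \<and>
    v \<bullet> x 1 = - h * (v \<bullet> y 0) \<and> v \<bullet> y 1 = h * (v \<bullet> x 0)}"

lemma subspace_N: "subspace N"
  by (auto simp: N_def subspace_def inner_left_distrib algebra_simps)

lemma subspace_N_perp: "subspace N_perp"
  by (auto simp: N_perp_def subspace_def inner_left_distrib algebra_simps)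

lemma nij_in_N: "nij u v \<in> N"
proof -
  have p: "p i = 0" if "k < i" for i
    using that by (simp add: p_def)
  show ?thesis
  proof (cases "k = 0")
    case True
    then have 0: "p i = 0" "h * t = 0" for i t
      using h_0 unfolding p_def by simp_all
    show ?thesis
      unfolding N_def nij_def by (auto simp: inner_diff_left q_def algebra_simps 0)
  next
    case False
    then have "p (Suc 0) = 1"
      by (simp add: p_def)
    then show ?thesis
      unfolding N_def nij_def by (auto simp: inner_diff_left p q_def algebra_simps)
  qed
qed

text \<open>One argument can be fixed as \<open>x 0\<close>, the direction that acts: the values
  \<open>nij (x 0) w\<close> already fill \<open>N\<close>.\<close>

lemma N_subset_nij: "v \<in> N \<Longrightarrow> \<exists>w. v = nij (x 0) w"
proof (intro exI coordinates_eqI)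
  fix i assume v: "v \<in> N" and i: "i < n"
  \<comment> \<open>For \<open>1 \<le> i \<le> k\<close>, \<open>nij (x 0) w\<close> has coordinates
    \<open>- 2 (w \<bullet> x i)\<close> and \<open>2 (w \<bullet> y i)\<close>, which
    \<open>?w\<close> inverts. The halves turn the entry \<open>2 * h\<close> of \<open>D\<close>
    into the factor \<open>h\<close> of \<open>N\<close>.\<close>
  let ?w = "comb (\<lambda>i. - p i * (v \<bullet> x i) / 2) (\<lambda>i. p i * (v \<bullet> y i) / 2)"
  have h: "h * p 1 = h"
    using h_0 by (auto simp: p_def)
  show "v \<bullet> x i = nij (x 0) ?w \<bullet> x i" "v \<bullet> y i = nij (x 0) ?w \<bullet> y i"
    using v i h unfolding N_def nij_def
    by (auto simp: inner_diff_left p_def q_def)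
qed

lemma span_nij: "span {nij u v | u v. True} = N"
proof
  show "span {nij u v | u v. True} \<subseteq> N"
    by (rule span_minimal) (auto simp: nij_in_N subspace_N)
  show "N \<subseteq> span {nij u v | u v. True}"
    using N_subset_nij span_superset by fastforce
qed

text \<open>\<open>N\<close> is the graph of a linear map from the coordinate subspace
  \<open>S\<close> of indices \<open>1\<close> to \<open>k\<close> into the plane of
  \<open>x 0\<close> and \<open>y 0\<close>; the shear \<open>T\<close> carries \<open>S\<close>
  onto it.\<close>

lemma dim_N: "dim N = 2 * k"
proof -
  define d where "d = x ` {1..k} \<union> y ` {1..k}"
  define S where "S = {v. \<forall>b\<in>Basis. b \<notin> d \<longrightarrow> v \<bullet> b = 0}"
  define T where "T v = v + comb (\<lambda>i. if i = 0 then - h * (v \<bullet> y 1) else 0)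
    (\<lambda>i. if i = 0 then h * (v \<bullet> x 1) else 0)" for v
  have sub: "{1..k} \<subseteq> {..<n}"
    using k_less by auto
  have x_d: "x i \<in> d \<longleftrightarrow> 1 \<le> i \<and> i \<le> k" and y_d: "y i \<in> d \<longleftrightarrow> 1 \<le> i \<and> i \<le> k" if "i < n" for i
    using that sub disjoint inj_on_image_mem_iff[OF inj_x _ sub] inj_on_image_mem_iff[OF inj_y _ sub]
    by (auto simp: d_def)
  have S: "S = {v. \<forall>i<n. i = 0 \<or> k < i \<longrightarrow> v \<bullet> x i = 0 \<and> v \<bullet> y i = 0}"
    unfolding S_def Basis_eq using x_d y_d by (auto simp: not_le)
  have "card d = card (x ` {1..k}) + card (y ` {1..k})"
    unfolding d_def using disjoint sub by (intro card_Un_disjoint) auto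
  also have "\<dots> = 2 * k"
    using card_image[OF inj_on_subset[OF inj_x sub]] card_image[OF inj_on_subset[OF inj_y sub]] by simp
  finally have "card d = 2 * k" .
  moreover have "d \<subseteq> Basis"
    unfolding d_def Basis_eq using sub by auto
  ultimately have "dim S = 2 * k"
    unfolding S_def by (simp add: dim_substandard)
  moreover have "dim (T ` S) = dim S"
  proof (rule dim_image_eq)
    show "linear T"
      by (intro linearI coordinates_eqI) (auto simp: T_def inner_left_distrib algebra_simps)
    \<comment> \<open>\<open>T\<close> changes only the coordinates of index \<open>0\<close>, and
      these vanish on \<open>S\<close>.\<close>
    have "u = v" if "T u = T v" "u \<in> S" "v \<in> S" for u v
    proof (rule coordinates_eqI)
      fix i assume "i < n"
      have "T u \<bullet> x i = T v \<bullet> x i" "T u \<bullet> y i = T v \<bullet> y i"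
        using that by simp_all
      then show "u \<bullet> x i = v \<bullet> x i" "u \<bullet> y i = v \<bullet> y i"
        using \<open>i < n\<close> that(2,3)
        by (cases "i = 0"; auto simp: T_def inner_left_distrib S)+
    qed
    then have "inj_on T S"
      by (rule inj_onI)
    moreover have "span S = S"
      unfolding S by (rule span_eq_iff[THEN iffD2]) (auto simp: subspace_def inner_left_distrib)
    ultimately show "inj_on T (span S)"
      by (simp only:)
  qed
  moreover have "T ` S = N"
  proof
    show "T ` S \<subseteq> N"
    proof
      fix v assume "v \<in> T ` S"
      then obtain u where u: "v = T u" "u \<in> S" by blast
      then have "u \<bullet> x 0 = 0" "u \<bullet> y 0 = 0"
        using n_pos(1) unfolding S by blast+
      then show "v \<in> N"
        using u by (auto simp: S N_def T_def inner_left_distrib)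
    qed
    show "N \<subseteq> T ` S"
    proof
      fix v assume v: "v \<in> N"
      define w where "w = comb (\<lambda>i. if i = 0 then 0 else v \<bullet> x i) (\<lambda>i. if i = 0 then 0 else v \<bullet> y i)"
      have "v = T w"
        using v by (intro coordinates_eqI) (auto simp: T_def w_def inner_left_distrib N_def)
      moreover have "w \<in> S"
        using v by (auto simp: S w_def N_def)
      ultimately show "v \<in> T ` S" by blast
    qed
  qed
  ultimately show ?thesis by simp
qed

lemma orthogonal_N:
  assumes "0 < k"
  shows "{v. \<forall>u\<in>N. J u \<bullet> v = 0} = N_perp"
proof (intro subset_antisym subsetI)
  fix v assume "v \<in> N_perp"
  have "J u \<bullet> v = 0" if "u \<in> N" for u
  proof -
    have "{..<n} = insert 0 (insert 1 {2..<n})"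
      using n_ge by auto
    then have "J u \<bullet> v = (u \<bullet> x 0) * (v \<bullet> y 0) - (u \<bullet> y 0) * (v \<bullet> x 0) +
      ((u \<bullet> x 1) * (v \<bullet> y 1) - (u \<bullet> y 1) * (v \<bullet> x 1)) +
      (\<Sum>i=2..<n. (u \<bullet> x i) * (v \<bullet> y i) - (u \<bullet> y i) * (v \<bullet> x i))"
      by (simp add: inner_J_eq_sum)
    also have "(\<Sum>i=2..<n. (u \<bullet> x i) * (v \<bullet> y i) - (u \<bullet> y i) * (v \<bullet> x i)) = 0"
    proof (rule sum.neutral, rule ballI)
      \<comment> \<open>For \<open>i \<le> k\<close> the coordinates of \<open>v\<close> vanish, for
        \<open>i > k\<close> those of \<open>u\<close>; the terms of index \<open>0\<close> and
        \<open>1\<close> cancel against each other.\<close>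
      fix i assume "i \<in> {2..<n}"
      then show "(u \<bullet> x i) * (v \<bullet> y i) - (u \<bullet> y i) * (v \<bullet> x i) = 0"
        using \<open>u \<in> N\<close> \<open>v \<in> N_perp\<close> by (cases "i \<le> k") (auto simp: N_def N_perp_def)
    qed
    finally show ?thesis
      using \<open>u \<in> N\<close> \<open>v \<in> N_perp\<close> by (simp add: N_def N_perp_def)
  qed
  then show "v \<in> {v. \<forall>u\<in>N. J u \<bullet> v = 0}" by simp
next
  fix v assume "v \<in> {v. \<forall>u\<in>N. J u \<bullet> v = 0}"
  then have v: "u \<bullet> J v = 0" if "u \<in> N" for u
    using that inner_J[of u v] by auto
  have "x 1 + h *\<^sub>R y 0 \<in> N" "y 1 - h *\<^sub>R x 0 \<in> N"
    using \<open>0 < k\<close> n_ge by (auto simp: N_def inner_left_distrib inner_diff_left)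
  from this[THEN v] have "v \<bullet> x 1 = - h * (v \<bullet> y 0)" "v \<bullet> y 1 = h * (v \<bullet> x 0)"
    by (auto simp: inner_right_distrib inner_diff_right inner_commute[of _ "J v"])
  moreover have "v \<bullet> x i = 0 \<and> v \<bullet> y i = 0" if "2 \<le> i" "i \<le> k" for i
  proof -
    have "x i \<in> N" "y i \<in> N"
      using that k_less n_ge by (auto simp: N_def)
    from this[THEN v] show ?thesis
      using that k_less by (auto simp: inner_commute[of _ "J v"])
  qed
  ultimately show "v \<in> N_perp"
    by (auto simp: N_perp_def)
qed

section \<open>Involutivity criteria\<close>

lemma br_N:
  assumes "0 < k"
  shows "(\<forall>u\<in>N. \<forall>v\<in>N. br u v \<in> N) \<longleftrightarrow> h = 0 \<or> l = - 1"
proof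
  assume *: "h = 0 \<or> l = - 1"
  have "br u v \<in> N" if "u \<in> N" "v \<in> N" for u v
    using that * \<open>0 < k\<close> unfolding N_def
    by (auto simp: p_def q_def algebra_simps)
  then show "\<forall>u\<in>N. \<forall>v\<in>N. br u v \<in> N" by blast
next
  assume *: "\<forall>u\<in>N. \<forall>v\<in>N. br u v \<in> N"
  \<comment> \<open>The first generator acts as \<open>- h D\<close>, and
    \<open>D (x 1 + h y 0) = x 1 + h (l + 2) y 0\<close> must lie on the line of
    \<open>x 1 + h y 0\<close> unless \<open>h = 0\<close>.\<close>
  have "y 1 - h *\<^sub>R x 0 \<in> N" "x 1 + h *\<^sub>R y 0 \<in> N"
    using \<open>0 < k\<close> n_ge by (auto simp: N_def inner_left_distrib inner_diff_left)
  then have "br (y 1 - h *\<^sub>R x 0) (x 1 + h *\<^sub>R y 0) \<in> N"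
    using * by blast
  then have "h * (h * (l + 1)) = 0"
    using \<open>0 < k\<close> by (simp add: N_def inner_left_distrib inner_diff_left p_def q_def algebra_simps)
  then show "h = 0 \<or> l = - 1"
    by auto
qed

lemma br_N_perp:
  assumes "0 < k"
  shows "(\<forall>u\<in>N_perp. \<forall>v\<in>N_perp. br u v \<in> N_perp) \<longleftrightarrow> h = 0 \<or> l - 1 = 2 * h\<^sup>2"
proof
  assume *: "h = 0 \<or> l - 1 = 2 * h\<^sup>2"
  have "br u v \<in> N_perp" if "u \<in> N_perp" "v \<in> N_perp" for u v
    using that * \<open>0 < k\<close> k_less unfolding N_perp_def
    by (auto simp: p_def q_def power2_eq_square algebra_simps)
  then show "\<forall>u\<in>N_perp. \<forall>v\<in>N_perp. br u v \<in> N_perp" by blast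
next
  assume *: "\<forall>u\<in>N_perp. \<forall>v\<in>N_perp. br u v \<in> N_perp"
  \<comment> \<open>The first vector acts as \<open>D\<close>, and
    \<open>D (y 0 - h x 1) = (l - 2 h^2) y 0 - h x 1\<close> must lie on the line of
    \<open>y 0 - h x 1\<close>.\<close>
  have "x 0 + h *\<^sub>R y 1 \<in> N_perp" "y 0 - h *\<^sub>R x 1 \<in> N_perp"
    using \<open>0 < k\<close> n_ge k_less by (auto simp: N_perp_def inner_left_distrib inner_diff_left)
  then have "br (x 0 + h *\<^sub>R y 1) (y 0 - h *\<^sub>R x 1) \<in> N_perp"
    using * by blast
  then have "h * (l - 1 - 2 * h\<^sup>2) = 0"
    using \<open>0 < k\<close>
    by (simp add: N_perp_def inner_left_distrib inner_diff_left p_def q_def power2_eq_square algebra_simps)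
  then show "h = 0 \<or> l - 1 = 2 * h\<^sup>2"
    by auto
qed

lemma im_nijenhuis_eq: "im_nijenhuis euclidean_manifold JJ = left_dist N"
  by (simp only: im_nijenhuis_JJ span_nij)

lemma realizes:
  shows "symplectic_lie_group euclidean_manifold G \<omega>" "almost_complex euclidean_manifold JJ"
    "left_invariant_endo euclidean_manifold G JJ" "positive_compatible euclidean_manifold \<omega> JJ"
    "constant_rank euclidean_manifold (im_nijenhuis euclidean_manifold JJ) (2 * k)"
    "0 < k \<Longrightarrow> involutive euclidean_manifold (im_nijenhuis euclidean_manifold JJ) \<longleftrightarrow> h = 0 \<or> l = - 1"
    "0 < k \<Longrightarrow> involutive euclidean_manifold (symp_orthogonal \<omega> (im_nijenhuis euclidean_manifold JJ))
      \<longleftrightarrow> h = 0 \<or> l - 1 = 2 * h\<^sup>2"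
  using symplectic_lie_group_\<omega> almost_complex_JJ left_invariant_JJ positive_compatible_JJ
    constant_rank_left_dist[OF subspace_N] br_N br_N_perp
    involutive_left_dist[OF subspace_N] involutive_left_dist[OF subspace_N_perp]
  by (simp_all add: im_nijenhuis_eq symp_orthogonal_left_dist orthogonal_N dim_N)

end

text \<open>
  Since \<open>B\<close> takes values in the span of the \<open>y i\<close>, which \<open>B\<close> annihilates, the group is
  nilpotent of step 2. The coefficients \<open>-2, 1, 1\<close> add up to \<open>0\<close>, which makes \<open>\<omega>\<close> closed.
\<close>

locale two_step_nilpotent = symplectic_basis n x y
  for n and x y :: "nat \<Rightarrow> 'e::euclidean_space" +
  assumes n_ge: "n \<ge> 3"
begin

text \<open>The group law will be \<open>u + v + B u v\<close>; the bracket is the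
  antisymmetrization of \<open>B\<close>, so one ordering of each pair of arguments suffices
  here.\<close>

definition B :: "'e \<Rightarrow> 'e \<Rightarrow> 'e" where
  "B u v = comb (\<lambda>i. 0)
    (\<lambda>i. if i = 0 then - 2 * (u \<bullet> x 1) * (v \<bullet> x 2)
         else if i = 1 then (u \<bullet> x 2) * (v \<bullet> x 0)
         else if i = 2 then (u \<bullet> x 0) * (v \<bullet> x 1)
         else (u \<bullet> x 0) * (v \<bullet> x i))"

lemma n_gt [simp]: "0 < n" "Suc 0 < n" "2 < n"
  using n_ge by auto

lemma inner_B [simp]:
  assumes "i < n"
  shows "B u v \<bullet> x i = 0"
    "B u v \<bullet> y i = (if i = 0 then - 2 * (u \<bullet> x 1) * (v \<bullet> x 2)
       else if i = 1 then (u \<bullet> x 2) * (v \<bullet> x 0)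
       else if i = 2 then (u \<bullet> x 0) * (v \<bullet> x 1)
       else (u \<bullet> x 0) * (v \<bullet> x i))"
  using assms by (simp_all add: B_def)

lemma linear_B_right: "linear (B u)"
  by (intro linearI coordinates_eqI) (auto simp: inner_left_distrib algebra_simps)

lemma linear_B_left: "linear (\<lambda>u. B u v)"
  by (intro linearI coordinates_eqI) (auto simp: inner_left_distrib algebra_simps)

lemma B_B: "B (B u v) w = 0" "B u (B v w) = 0"
  by (rule coordinates_eqI; simp)+

sublocale affine_lie_group "\<lambda>u v. v + B u v" B
proof (rule affine_lie_group.intro)
  show "linear (\<lambda>v. v + B u v)" for u
    by (rule linear_compose_add[OF linear_ident linear_B_right])
  show "v + B (u + (w + B u w)) v = v + B w v + B u (v + B w v)" for u v w
    by (simp add: linear_add[OF linear_B_left] linear_add[OF linear_B_right] B_B add_ac)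
  show "v + B u v + B (- u) (v + B u v) = v" for u v
    by (simp add: linear_neg[OF linear_B_left] linear_add[OF linear_B_right] B_B)
  show "smooth_on UNIV (\<lambda>u. v + B u v)" for v
    by (rule smooth_on_add[OF smooth_on_const smooth_on_linear[OF linear_B_left]])
  show "((\<lambda>u. v + B u v) has_derivative (\<lambda>u. B u v)) (at 0)" for v
    using has_derivative_add[OF has_derivative_const linear_imp_has_derivative[OF linear_B_left]]
    by simp
qed

lemma inner_br [simp]:
  assumes "i < n"
  shows "br u v \<bullet> x i = 0" "br u v \<bullet> y i = B u v \<bullet> y i - B v u \<bullet> y i"
  using assms by (simp_all add: br_def inner_diff_left del: inner_B(2))

sublocale affine_symplectic_group "\<lambda>u v. v + B u v" B J
proof (rule affine_symplectic_group.intro[OF affine_lie_group_axioms],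
    rule affine_symplectic_group_axioms.intro)
  fix u v w
  have split: "{..<n} = insert 0 (insert 1 (insert 2 {3..<n}))"
    using n_ge by auto
  have sum: "J (br u v) \<bullet> w = - (br u v \<bullet> y 0) * (w \<bullet> x 0) - (br u v \<bullet> y 1) * (w \<bullet> x 1)
      - (br u v \<bullet> y 2) * (w \<bullet> x 2)
      - (\<Sum>i=3..<n. ((u \<bullet> x 0) * (v \<bullet> x i) - (v \<bullet> x 0) * (u \<bullet> x i)) * (w \<bullet> x i))" for u v w
  proof -
    have "J (br u v) \<bullet> w = (\<Sum>i<n. - (br u v \<bullet> y i) * (w \<bullet> x i))"
      unfolding inner_J_eq_sum by (rule sum.cong) (simp_all del: inner_br(2))
    also have "\<dots> = - (br u v \<bullet> y 0) * (w \<bullet> x 0) - (br u v \<bullet> y 1) * (w \<bullet> x 1)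
      - (br u v \<bullet> y 2) * (w \<bullet> x 2) + (\<Sum>i=3..<n. - (br u v \<bullet> y i) * (w \<bullet> x i))"
      unfolding split by (simp del: inner_br)
    also have "(\<Sum>i=3..<n. - (br u v \<bullet> y i) * (w \<bullet> x i)) =
      - (\<Sum>i=3..<n. ((u \<bullet> x 0) * (v \<bullet> x i) - (v \<bullet> x 0) * (u \<bullet> x i)) * (w \<bullet> x i))"
      unfolding sum_negf[symmetric] by (rule sum.cong) (auto simp: algebra_simps)
    finally show ?thesis
      by (simp del: inner_br)
  qed
  have "(\<Sum>i=3..<n. ((u \<bullet> x 0) * (v \<bullet> x i) - (v \<bullet> x 0) * (u \<bullet> x i)) * (w \<bullet> x i))
    + (\<Sum>i=3..<n. ((v \<bullet> x 0) * (w \<bullet> x i) - (w \<bullet> x 0) * (v \<bullet> x i)) * (u \<bullet> x i))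
    + (\<Sum>i=3..<n. ((w \<bullet> x 0) * (u \<bullet> x i) - (u \<bullet> x 0) * (w \<bullet> x i)) * (v \<bullet> x i)) = 0"
    by (simp add: sum.distrib[symmetric] algebra_simps)
  \<comment> \<open>For the indices \<open>0, 1, 2\<close> the cyclic sums are
    \<open>2, - 1, - 1\<close> times the determinant of the coordinates along
    \<open>x 0, x 1, x 2\<close>.\<close>
  then show "J (br u v) \<bullet> w + J (br v w) \<bullet> u + J (br w u) \<bullet> v = 0"
    unfolding sum by (simp add: algebra_simps)
qed (rule linear_J J_J inner_J_J)+

text \<open>The \<open>y i\<close> are central, so on vectors without \<open>y\<close>-part only one
  of the four terms of \<open>nij u (- v)\<close> or \<open>nij u (J v)\<close> survives. Brackets
  reach every \<open>y i\<close>, and \<open>J\<close> of them every \<open>x i\<close> up to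
  sign.\<close>

lemma span_nij: "span {nij u v | u v. True} = UNIV"
proof -
  have ex: "\<exists>u v. br u v = y i \<and> (\<forall>j<n. u \<bullet> y j = 0) \<and> (\<forall>j<n. v \<bullet> y j = 0)" if "i < n" for i
  proof -
    consider "i = 0" | "i = 1" | "i = 2" | "i \<ge> 3"
      by linarith
    then show ?thesis
    proof cases
      case 1
      \<comment> \<open>The factor \<open>- 1/2\<close> undoes the structure constant
        \<open>- 2\<close>.\<close>
      have "br (x 1) (- (1/2) *\<^sub>R x 2) = y 0"
        by (rule coordinates_eqI) auto
      with 1 show ?thesis
        by (intro exI[of _ "x 1"] exI[of _ "- (1/2) *\<^sub>R x 2"]) simp
    next
      case 2
      have "br (x 2) (x 0) = y 1"
        by (rule coordinates_eqI) auto
      with 2 show ?thesis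
        by (intro exI[of _ "x 2"] exI[of _ "x 0"]) simp
    next
      case 3
      have "br (x 0) (x 1) = y 2"
        by (rule coordinates_eqI) auto
      with 3 show ?thesis
        by (intro exI[of _ "x 0"] exI[of _ "x 1"]) simp
    next
      case 4
      have "br (x 0) (x i) = y i"
        using 4 \<open>i < n\<close> by (intro coordinates_eqI) auto
      with \<open>i < n\<close> show ?thesis
        by (intro exI[of _ "x 0"] exI[of _ "x i"]) simp
    qed
  qed
  have nij: "nij u (- v) = br u v" "nij u (J v) = J (br u v)"
    if "\<forall>j<n. u \<bullet> y j = 0" "\<forall>j<n. v \<bullet> y j = 0" for u v
    using that by (intro coordinates_eqI; simp add: nij_def inner_diff_left)+
  have "x i \<in> span {nij u v | u v. True} \<and> y i \<in> span {nij u v | u v. True}" if "i < n" for i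
  proof -
    obtain u v where uv: "br u v = y i" "\<forall>j<n. u \<bullet> y j = 0" "\<forall>j<n. v \<bullet> y j = 0"
      using ex[OF \<open>i < n\<close>] by blast
    have "J (y i) = - x i"
      using that by (intro coordinates_eqI) auto
    then have "y i = nij u (- v)" "- x i = nij u (J v)"
      using nij[OF uv(2,3)] uv(1) by simp_all
    then have "y i \<in> span {nij u v | u v. True}" "- x i \<in> span {nij u v | u v. True}"
      by (metis (mono_tags, lifting) mem_Collect_eq span_base)+
    then show ?thesis
      using span_neg[of "- x i"] by simp
  qed
  then have "b \<in> span {nij u v | u v. True}" if "b \<in> Basis" for b
    using that unfolding Basis_eq by blast
  then have "span Basis \<subseteq> span {nij u v | u v. True}"
    by (intro span_minimal) auto
  then show ?thesis
    by auto
qed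

lemma im_nijenhuis_eq: "im_nijenhuis euclidean_manifold JJ = left_dist UNIV"
  by (simp only: im_nijenhuis_JJ span_nij)

lemma realizes:
  shows "symplectic_lie_group euclidean_manifold G \<omega>" "almost_complex euclidean_manifold JJ"
    "left_invariant_endo euclidean_manifold G JJ" "positive_compatible euclidean_manifold \<omega> JJ"
    "constant_rank euclidean_manifold (im_nijenhuis euclidean_manifold JJ) DIM('e)"
  using symplectic_lie_group_\<omega> almost_complex_JJ left_invariant_JJ positive_compatible_JJ
    constant_rank_left_dist[OF subspace_UNIV]
  by (simp_all add: im_nijenhuis_eq dim_UNIV)

end

section \<open>Choice of basis and parameters\<close>

lemma symplectic_basis_exists:
  assumes "DIM('e::euclidean_space) = 2 * n"
  obtains x y :: "nat \<Rightarrow> 'e::euclidean_space" where "symplectic_basis n x y"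
proof -
  obtain f where "bij_betw f {0..<DIM('e)} (Basis :: 'e set)"
    using ex_bij_betw_nat_finite[OF finite_Basis] by blast
  then have f: "bij_betw f {0..<2 * n} Basis"
    unfolding assms .
  have "(\<lambda>i. n + i) ` {..<n} = {n..<2 * n}"
    using image_add_atLeastLessThan[of n 0 n] by (simp add: atLeast0LessThan mult_2)
  then have split: "{0..<2 * n} = {..<n} \<union> (\<lambda>i. n + i) ` {..<n}"
    by auto
  have "symplectic_basis n f (\<lambda>i. f (n + i))"
  proof
    show "Basis = f ` {..<n} \<union> (\<lambda>i. f (n + i)) ` {..<n}"
      using bij_betw_imp_surj_on[OF f] unfolding split by (simp add: image_Un image_image)
    have inj: "f i = f j \<longleftrightarrow> i = j" if "i < 2 * n" "j < 2 * n" for i j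
      using inj_on_eq_iff[OF bij_betw_imp_inj_on[OF f]] that by simp
    show "inj_on f {..<n}"
      by (rule inj_onI) (simp add: inj)
    show "inj_on (\<lambda>i. f (n + i)) {..<n}"
      by (rule inj_onI) (simp add: inj)
    have "f i \<noteq> f (n + j)" if "i < n" "j < n" for i j
      using that by (simp add: inj)
    then show "f ` {..<n} \<inter> (\<lambda>i. f (n + i)) ` {..<n} = {}"
      by blast
  qed
  then show thesis
    by (rule that)
qed

theorem proposition4p4:
  fixes n k :: nat
  assumes "DIM('e::euclidean_space) = 2 * n"
    and "n \<ge> 2" and "k \<le> n" and "n = 2 \<Longrightarrow> k < n"
  shows "(\<exists>(M :: ('e, 'e) manifold) (G :: 'e monoid) \<omega> J.
            symplectic_lie_group M G \<omega> \<and>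
            almost_complex M J \<and> left_invariant_endo M G J \<and> positive_compatible M \<omega> J \<and>
            constant_rank M (im_nijenhuis M J) (2 * k))
       \<and> (0 < k \<and> k < n \<longrightarrow>
          (\<forall>a b :: bool. \<exists>(M :: ('e, 'e) manifold) (G :: 'e monoid) \<omega> J.
            symplectic_lie_group M G \<omega> \<and>
            almost_complex M J \<and> left_invariant_endo M G J \<and> positive_compatible M \<omega> J \<and>
            constant_rank M (im_nijenhuis M J) (2 * k) \<and>
            (involutive M (im_nijenhuis M J) \<longleftrightarrow> a) \<and>
            (involutive M (symp_orthogonal \<omega> (im_nijenhuis M J)) \<longleftrightarrow> b)))"
proof -
  obtain x y :: "nat \<Rightarrow> 'e" where xy: "symplectic_basis n x y"
    using symplectic_basis_exists[OF assms(1)] .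
  show ?thesis
  proof (intro conjI impI allI)
    show "\<exists>(M :: ('e, 'e) manifold) (G :: 'e monoid) \<omega> J.
            symplectic_lie_group M G \<omega> \<and>
            almost_complex M J \<and> left_invariant_endo M G J \<and> positive_compatible M \<omega> J \<and>
            constant_rank M (im_nijenhuis M J) (2 * k)"
    proof (cases "k = n")
      case True
      \<comment> \<open>Full rank is excluded for \<open>n = 2\<close>, so the nilpotent family
        applies.\<close>
      then have "n \<ge> 3"
        using assms(2,4) by (cases "n = 2") auto
      then have "two_step_nilpotent n x y"
        using xy by (simp add: two_step_nilpotent_def two_step_nilpotent_axioms_def)
      from two_step_nilpotent.realizes[OF this] show ?thesis
        unfolding assms(1) True by blast
    next
      case False
      \<comment> \<open>\<open>l = h = 0\<close> is admissible for every \<open>k < n\<close>,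
        including \<open>k = 0\<close>, where \<open>h\<close> must vanish.\<close>
      then have "almost_abelian n x y k 0 0"
        using xy assms by (auto simp: almost_abelian_def almost_abelian_axioms_def)
      from almost_abelian.realizes(1-5)[OF this] show ?thesis
        by blast
    qed
  next
    fix a b :: bool
    assume k: "0 < k \<and> k < n"
    \<comment> \<open>With \<open>h = 1\<close> the criteria read \<open>l = - 1\<close> and
      \<open>l = 3\<close>, and \<open>l = 0\<close> violates both; \<open>h = 0\<close> satisfies
      both. The excluded value \<open>l = 1\<close> never occurs.\<close>
    define h l :: real where "h = (if a \<and> b then 0 else 1)" and
      "l = (if a then if b then 0 else - 1 else if b then 3 else 0)"
    have "almost_abelian n x y k l h"
      using xy assms k by (auto simp: almost_abelian_def almost_abelian_axioms_def l_def)
    note R = almost_abelian.realizes[OF this]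
    have eq: "(h = 0 \<or> l = - 1) = a" "(h = 0 \<or> l - 1 = 2 * h\<^sup>2) = b"
      by (auto simp: h_def l_def)
    show "\<exists>(M :: ('e, 'e) manifold) (G :: 'e monoid) \<omega> J.
            symplectic_lie_group M G \<omega> \<and>
            almost_complex M J \<and> left_invariant_endo M G J \<and> positive_compatible M \<omega> J \<and>
            constant_rank M (im_nijenhuis M J) (2 * k) \<and>
            (involutive M (im_nijenhuis M J) \<longleftrightarrow> a) \<and>
            (involutive M (symp_orthogonal \<omega> (im_nijenhuis M J)) \<longleftrightarrow> b)"
      by (intro exI conjI) (rule R(1), rule R(2), rule R(3), rule R(4), rule R(5),
          rule trans[OF R(6) eq(1)], simp add: k, rule trans[OF R(7) eq(2)], simp add: k)
  qed
qed

end
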